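(* Let $\epsilon = 1/4$. Any (possibly randomized, adaptive) tester that, given $\mathsf{COND}$ query access to two unknown distributions $D_1, D_2$ over $[n]$, distinguishes with probability at least $2/3$ between the case $D_1 = D_2$ and the case $d_{TV}(D_1,D_2) \ge \epsilon$, must make $\tilde{\Omega}(\log\log n)$ $\mathsf{COND}$ queries, where $\tilde{\Omega}$ hides a $\mathrm{poly}(\log\log\log n)$ factor.
   Context: For distributions $D$ over $[n]$ and $A\subseteq[n]$, write $D(A)=\sum_{a\in A}D(a)$. The total variation distance is $d_{TV}(D_1,D_2)=\frac12\sum_{s\in[n]}|D_1(s)-D_2(s)|$. For $A\subseteq[n]$, the conditional distribution $D|_A$ is the distribution on $A$ with mass $D(a)/D(A)$ on $a\in A$ if $D(A)>0$, and uniform on $A$ if $D(A)=0$. A $\mathsf{COND}$ query to $D$ consists of choosing any subset $A\subseteq[n]$ (possibly depending on all previous answers) and receiving a sample drawn from $D|_A$; a tester with access to two distributions may query either of them, each query counting once. The tester is required to be correct with probability at least $2/3$ on every input pair (standard constant success probability). *)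

theory Defs
  imports "HOL-Probability.Probability"
begin

definition dist_on :: "nat \<Rightarrow> nat pmf \<Rightarrow> bool" where
  "dist_on n D \<longleftrightarrow> set_pmf D \<subseteq> {1..n}"

definition tv_dist :: "nat \<Rightarrow> nat pmf \<Rightarrow> nat pmf \<Rightarrow> real" where
  "tv_dist n D1 D2 = 1 / 2 * (\<Sum>s\<in>{1..n}. \<bar>pmf D1 s - pmf D2 s\<bar>)"

definition cond_dist :: "nat pmf \<Rightarrow> nat set \<Rightarrow> nat pmf" where
  "cond_dist D A = (if measure_pmf.prob D A > 0 then cond_pmf D A else pmf_of_set A)"

lemma pmf_cond_dist:
  assumes "finite A" "A \<noteq> {}" "a \<in> A"
  shows "pmf (cond_dist D A) a =
    (if measure_pmf.prob D A > 0 then pmf D a / measure_pmf.prob D A else 1 / card A)"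
proof (cases "measure_pmf.prob D A > 0")
  case True
  then have "set_pmf D \<inter> A \<noteq> {}"
    by (metis less_irrefl measure_pmf_zero_iff)
  then show ?thesis
    using True assms by (simp add: cond_dist_def pmf_cond)
next
  case False
  then show ?thesis
    using assms by (simp add: cond_dist_def)
qed

datatype side = First | Second

text \<open>
  A randomized adaptive tester is a decision tree that may toss coins of arbitrary discrete
  distribution, query either of the two distributions on a set and branch on the sample received,
  or halt with a verdict (\<^const>\<open>True\<close> for accept).
\<close>

datatype tester =
    Output bool
  | Coin "nat pmf" "nat \<Rightarrow> tester"
  | Query side "nat set" "nat \<Rightarrow> tester"

text \<open>
  The following two predicates only inspect branches that can be reached: a query to \<open>A\<close>
  always returns an element of \<open>A\<close>. Conversely, if both distributions are uniform
  on \<open>{1..n}\<close>, every such branch is reached with positive probability. The empty set, on which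
  there is no conditional distribution, may not be queried.
\<close>

primrec valid_tester :: "nat \<Rightarrow> tester \<Rightarrow> bool" where
  "valid_tester n (Output b) \<longleftrightarrow> True"
| "valid_tester n (Coin p T) \<longleftrightarrow> (\<forall>x\<in>set_pmf p. valid_tester n (T x))"
| "valid_tester n (Query i A T) \<longleftrightarrow>
     A \<noteq> {} \<and> A \<subseteq> {1..n} \<and> (\<forall>a\<in>A. valid_tester n (T a))"

primrec queries_at_most :: "tester \<Rightarrow> nat \<Rightarrow> bool" where
  "queries_at_most (Output b) q \<longleftrightarrow> True"
| "queries_at_most (Coin p T) q \<longleftrightarrow> (\<forall>x\<in>set_pmf p. queries_at_most (T x) q)"
| "queries_at_most (Query i A T) q \<longleftrightarrow> q \<ge> 1 \<and> (\<forall>a\<in>A. queries_at_most (T a) (q - 1))"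

primrec run_tester :: "nat pmf \<Rightarrow> nat pmf \<Rightarrow> tester \<Rightarrow> bool pmf" where
  "run_tester D1 D2 (Output b) = return_pmf b"
| "run_tester D1 D2 (Coin p T) = bind_pmf p (\<lambda>x. run_tester D1 D2 (T x))"
| "run_tester D1 D2 (Query i A T) =
     bind_pmf (cond_dist (case i of First \<Rightarrow> D1 | Second \<Rightarrow> D2) A)
       (\<lambda>a. run_tester D1 D2 (T a))"

definition equivalence_tester :: "nat \<Rightarrow> real \<Rightarrow> tester \<Rightarrow> bool" where
  "equivalence_tester n \<epsilon> T \<longleftrightarrow>
     valid_tester n T \<and>
     (\<forall>D1 D2. dist_on n D1 \<longrightarrow> dist_on n D2 \<longrightarrow>
        (D1 = D2 \<longrightarrow> pmf (run_tester D1 D2 T) True \<ge> 2 / 3) \<and>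
        (tv_dist n D1 D2 \<ge> \<epsilon> \<longrightarrow> pmf (run_tester D1 D2 T) False \<ge> 2 / 3))"

end

theory Submission
  imports Defs "HOL-Real_Asymp.Real_Asymp"
begin

text \<open>
  Hard instances: every element of \<open>[n]\<close> independently draws a level and a sign. Level \<open>l < r\<close> at
  scale \<open>s\<close> has probability \<open>1 / W s l\<close> and weight \<open>W s l\<close>, where the \<open>W s l\<close> decrease geometrically
  in \<open>l\<close> by a factor \<open>B\<close>; the remaining elements are on the bottom level \<open>r\<close>, which carries the
  same expected weight as each other level. Equal pairs are proportional to the weights; far pairs
  multiply them by \<open>1 \<plusminus> 9/10\<close> according to the sign, oppositely for the two distributions.

  Let \<open>f\<close> be the number of elements of a queried set that the tester has not yet drawn from above
  the bottom. If \<open>f\<close> is far above the range of the weights at the true scale, the answer is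
  nearly a uniform unseen element with a uniform level. If \<open>f\<close> is far below this range, the answer
  is nearly determined by the order of the levels already seen. In both cases the signs
  do not matter as long as no level repeats, which is unlikely with \<open>r \<approx> 100 q\<^sup>2\<close> levels. Each
  query thus only tells whether the true scale lies above or below \<open>f\<close>, so \<open>q\<close> queries rule out
  at most \<open>2\<^sup>q\<close> scales, whereas about \<open>ln n\<close> of them, up to a factor polynomial in \<open>q\<close>, fit
  into \<open>[n]\<close>. The exponent \<open>k = 0\<close> suffices.
\<close>

section \<open>Finite product distributions\<close>

lemma finite_set_Pi_pmf:
  assumes "finite A" "\<And>x. x \<in> A \<Longrightarrow> finite (set_pmf (m x))"
  shows "finite (set_pmf (Pi_pmf A d m))"
  using assms by (auto simp: set_Pi_pmf)

lemma expectation_mono_finite: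
  fixes f g :: "'a \<Rightarrow> real"
  assumes "finite (set_pmf M)" "\<And>x. x \<in> set_pmf M \<Longrightarrow> f x \<le> g x"
  shows "measure_pmf.expectation M f \<le> measure_pmf.expectation M g"
  using assms by (intro integral_mono_AE integrable_measure_pmf_finite)
    (auto simp: AE_measure_pmf_iff)

lemma expectation_cong_set_pmf:
  fixes f g :: "'a \<Rightarrow> real"
  assumes "\<And>x. x \<in> set_pmf M \<Longrightarrow> f x = g x"
  shows "measure_pmf.expectation M f = measure_pmf.expectation M g"
  using assms by (intro integral_cong_AE) (auto simp: AE_measure_pmf_iff)

lemma abs_expectation_diff_le:
  fixes f g h :: "'a \<Rightarrow> real"
  assumes "finite (set_pmf M)" "\<And>x. x \<in> set_pmf M \<Longrightarrow> \<bar>f x - g x\<bar> \<le> h x"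
  shows "\<bar>measure_pmf.expectation M f - measure_pmf.expectation M g\<bar> \<le> measure_pmf.expectation M h"
proof -
  note int = integrable_measure_pmf_finite[OF assms(1)]
  have "measure_pmf.expectation M f - measure_pmf.expectation M g =
      measure_pmf.expectation M (\<lambda>x. f x - g x)"
    by (simp add: int)
  also have "\<bar>\<dots>\<bar> \<le> measure_pmf.expectation M (\<lambda>x. \<bar>f x - g x\<bar>)"
    by (rule integral_abs_bound)
  also have "\<dots> \<le> measure_pmf.expectation M h"
    using assms by (intro expectation_mono_finite)
  finally show ?thesis .
qed

text \<open>Coordinates are independent, so one of them may be sampled first and then frozen. This
  serves to condition on the type of a single element.\<close>

lemma Pi_pmf_bind_component:
  assumes "finite A" "a \<in> A"
  shows "Pi_pmf A d m = bind_pmf (m a) (\<lambda>t. Pi_pmf A d (m(a := return_pmf t)))"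
proof -
  define A' where "A' = A - {a}"
  have A: "A = insert a A'" "a \<notin> A'" "finite A'" using assms by (auto simp: A'_def)
  have "Pi_pmf A' d (m(a := return_pmf t)) = Pi_pmf A' d m" for t
    using A by (intro Pi_pmf_cong) auto
  then show ?thesis
    using A by (simp add: Pi_pmf_insert' bind_return_pmf)
qed

text \<open>Freezing coordinate \<open>a\<close> makes the factor \<open>h (\<tau> a)\<close>
  constant, while \<open>g\<close> may still depend on all coordinates. \<open>S\<close> may exceed
  the support, so that callers can sum over full rectangles of types.\<close>

lemma expectation_Pi_pmf_mult_component:
  fixes g :: "('a \<Rightarrow> 'b) \<Rightarrow> real"
  assumes A: "finite A" "a \<in> A" "\<And>x. x \<in> A \<Longrightarrow> finite (set_pmf (m x))"
    and S: "finite S" "set_pmf (m a) \<subseteq> S"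
  shows "measure_pmf.expectation (Pi_pmf A d m) (\<lambda>\<tau>. h (\<tau> a) * g \<tau>) =
    (\<Sum>t\<in>S. pmf (m a) t * h t * measure_pmf.expectation (Pi_pmf A d (m(a := return_pmf t))) g)"
proof -
  have fin: "finite (set_pmf (Pi_pmf A d (m(a := return_pmf t))))" for t
    using A by (intro finite_set_Pi_pmf) auto
  have "measure_pmf.expectation (Pi_pmf A d (m(a := return_pmf t))) (\<lambda>\<tau>. h (\<tau> a) * g \<tau>) =
      h t * measure_pmf.expectation (Pi_pmf A d (m(a := return_pmf t))) g" for t
  proof -
    have "measure_pmf.expectation (Pi_pmf A d (m(a := return_pmf t))) (\<lambda>\<tau>. h (\<tau> a) * g \<tau>) =
        measure_pmf.expectation (Pi_pmf A d (m(a := return_pmf t))) (\<lambda>\<tau>. h t * g \<tau>)"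
      using A by (intro expectation_cong_set_pmf) (auto simp: set_Pi_pmf PiE_dflt_def)
    then show ?thesis by simp
  qed
  then show ?thesis
    by (subst Pi_pmf_bind_component[OF A(1,2)], subst pmf_expectation_bind[OF S(1) fin S(2)])
       (simp_all add: mult_ac)
qed

lemma expectation_Pi_pmf_component:
  fixes h :: "'b \<Rightarrow> real"
  assumes "finite A" "a \<in> A"
  shows "measure_pmf.expectation (Pi_pmf A d m) (\<lambda>\<tau>. h (\<tau> a)) = measure_pmf.expectation (m a) h"
proof -
  have "measure_pmf.expectation (m a) h =
      measure_pmf.expectation (map_pmf (\<lambda>\<tau>. \<tau> a) (Pi_pmf A d m)) h"
    using assms by (simp add: Pi_pmf_component)
  then show ?thesis by simp
qed

text \<open>Cross terms vanish by independence and centring. Only coordinates in \<open>F\<close>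
  need the common law \<open>b\<close>; the others, later the elements already drawn, are
  arbitrary.\<close>

lemma variance_sum_Pi_pmf:
  fixes h :: "'b \<Rightarrow> real"
  assumes A: "finite A" "F \<subseteq> A" "\<And>x. x \<in> A \<Longrightarrow> finite (set_pmf (m x))"
    and b: "\<And>x. x \<in> F \<Longrightarrow> m x = b" "measure_pmf.expectation b h = 0"
  shows "measure_pmf.expectation (Pi_pmf A d m) (\<lambda>\<tau>. (\<Sum>a\<in>F. h (\<tau> a))\<^sup>2) =
    card F * measure_pmf.expectation b (\<lambda>t. (h t)\<^sup>2)"
proof -
  let ?E = "measure_pmf.expectation (Pi_pmf A d m)"
  note int = integrable_measure_pmf_finite[OF finite_set_Pi_pmf[OF A(1,3)]]
  have cross: "?E (\<lambda>\<tau>. h (\<tau> x) * h (\<tau> y)) =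
      (if x = y then measure_pmf.expectation b (\<lambda>t. (h t)\<^sup>2) else 0)"
    if "x \<in> F" "y \<in> F" for x y
  proof (cases "x = y")
    case True
    then show ?thesis
      using that A expectation_Pi_pmf_component[of A x d m "\<lambda>t. h t * h t"] b(1)
      by (auto simp: power2_eq_square)
  next
    case False
    have [simp]: "x \<in> A" "y \<in> A" using that A by auto
    show ?thesis
      using False that A b
      by (subst expectation_Pi_pmf_mult_component[OF _ _ _ _ order_refl])
         (auto simp: expectation_Pi_pmf_component)
  qed
  have "?E (\<lambda>\<tau>. (\<Sum>a\<in>F. h (\<tau> a))\<^sup>2) = (\<Sum>x\<in>F. \<Sum>y\<in>F. ?E (\<lambda>\<tau>. h (\<tau> x) * h (\<tau> y)))"
    by (simp add: power2_eq_square sum_product int Bochner_Integration.integral_sum)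
  also have "\<dots> = (\<Sum>x\<in>F. \<Sum>y\<in>F. if x = y then measure_pmf.expectation b (\<lambda>t. (h t)\<^sup>2) else 0)"
    by (intro sum.cong refl cross)
  also have "\<dots> = card F * measure_pmf.expectation b (\<lambda>t. (h t)\<^sup>2)"
    using finite_subset[OF A(2,1)] by simp
  finally show ?thesis .
qed

section \<open>Testers on weighted distributions\<close>

definition weighted_pmf :: "'a set \<Rightarrow> ('a \<Rightarrow> real) \<Rightarrow> 'a pmf" where
  "weighted_pmf S f = embed_pmf (\<lambda>x. if x \<in> S then f x / sum f S else 0)"

lemma pmf_weighted_pmf:
  assumes S: "finite S" "S \<noteq> {}" and f: "\<And>x. x \<in> S \<Longrightarrow> 0 < f x"
  shows "pmf (weighted_pmf S f) x = (if x \<in> S then f x / sum f S else 0)"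
  unfolding weighted_pmf_def
proof (rule pmf_embed_pmf)
  have pos: "0 < sum f S" using S f by (intro sum_pos) auto
  show "0 \<le> (if x \<in> S then f x / sum f S else 0)" for x
    using pos f[of x] by auto
  have "(\<integral>\<^sup>+ x. ennreal (if x \<in> S then f x / sum f S else 0) \<partial>count_space UNIV) =
      (\<Sum>x\<in>S. ennreal (f x / sum f S))"
    using S by (subst nn_integral_count_space'[where A = S]) auto
  also have "\<dots> = ennreal (\<Sum>x\<in>S. f x / sum f S)"
    using pos f by (intro sum_ennreal) (auto intro: less_imp_le)
  also have "(\<Sum>x\<in>S. f x / sum f S) = 1"
    using pos by (simp flip: sum_divide_distrib)
  finally show "(\<integral>\<^sup>+ x. ennreal (if x \<in> S then f x / sum f S else 0) \<partial>count_space UNIV) = 1"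
    by simp
qed

lemma set_weighted_pmf:
  assumes "finite S" "S \<noteq> {}" "\<And>x. x \<in> S \<Longrightarrow> 0 < f x"
  shows "set_pmf (weighted_pmf S f) = S"
proof -
  have "0 < sum f S" using assms by (intro sum_pos) auto
  then have "f x / sum f S \<noteq> 0" if "x \<in> S" for x
    using assms(3)[OF that] by simp
  then show ?thesis
    by (auto simp: set_pmf_eq pmf_weighted_pmf[OF assms])
qed

text \<open>The normalising sum over \<open>S\<close> cancels on conditioning, so answers depend
  only on the weights inside the queried set. Positivity of the weights excludes the uniform default
  for null sets.\<close>

lemma cond_dist_weighted_pmf:
  assumes S: "finite S" "A \<subseteq> S" "A \<noteq> {}" and f: "\<And>x. x \<in> S \<Longrightarrow> 0 < f x"
  shows "a \<in> A \<Longrightarrow> pmf (cond_dist (weighted_pmf S f) A) a = f a / sum f A"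
    and "set_pmf (cond_dist (weighted_pmf S f) A) \<subseteq> A"
proof -
  have fin: "finite A" and ne: "S \<noteq> {}" using S finite_subset by auto
  have pos: "0 < sum f S" "0 < sum f A" using S f fin ne by (auto intro!: sum_pos)
  have "measure_pmf.prob (weighted_pmf S f) A = (\<Sum>x\<in>A. f x / sum f S)"
    using S fin ne f
    by (subst measure_measure_pmf_finite) (auto simp: pmf_weighted_pmf intro!: sum.cong)
  also have "\<dots> = sum f A / sum f S" by (simp add: sum_divide_distrib)
  finally have prob: "measure_pmf.prob (weighted_pmf S f) A = sum f A / sum f S" .
  show "pmf (cond_dist (weighted_pmf S f) A) a = f a / sum f A" if "a \<in> A"
    using that S fin ne f pos
    by (subst pmf_cond_dist) (auto simp: prob pmf_weighted_pmf)
  have "0 < measure_pmf.prob (weighted_pmf S f) A" using pos by (simp add: prob)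
  moreover have "set_pmf (weighted_pmf S f) \<inter> A \<noteq> {}"
    using S ne f by (auto simp: set_weighted_pmf)
  ultimately show "set_pmf (cond_dist (weighted_pmf S f) A) \<subseteq> A"
    by (auto simp: cond_dist_def set_cond_pmf)
qed

definition accept_prob :: "nat \<Rightarrow> (side \<Rightarrow> nat \<Rightarrow> real) \<Rightarrow> tester \<Rightarrow> real" where
  "accept_prob n f T =
     pmf (run_tester (weighted_pmf {1..n} (f First)) (weighted_pmf {1..n} (f Second)) T) True"

lemma accept_prob_bounds: "0 \<le> accept_prob n f T" "accept_prob n f T \<le> 1"
  by (auto simp: accept_prob_def pmf_le_1)

lemma accept_prob_Output: "accept_prob n f (Output b) = of_bool b"
  by (simp add: accept_prob_def)

lemma accept_prob_Coin:
  "accept_prob n f (Coin p T) = measure_pmf.expectation p (\<lambda>x. accept_prob n f (T x))"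
  by (simp add: accept_prob_def pmf_bind)

lemma accept_prob_Query:
  assumes A: "A \<noteq> {}" "A \<subseteq> {1..n}" and f: "\<And>i x. 0 < f i x"
  shows "accept_prob n f (Query i A T) = (\<Sum>a\<in>A. f i a / sum (f i) A * accept_prob n f (T a))"
proof -
  have [simp]: "finite A" using A finite_subset by auto
  let ?D = "weighted_pmf {1..n} (f i)"
  have D: "(case i of First \<Rightarrow> weighted_pmf {1..n} (f First) | Second \<Rightarrow> weighted_pmf {1..n} (f Second)) = ?D"
    by (cases i) auto
  have "accept_prob n f (Query i A T) =
      measure_pmf.expectation (cond_dist ?D A) (\<lambda>a. accept_prob n f (T a))"
    unfolding accept_prob_def run_tester.simps D pmf_bind ..
  also have "\<dots> = (\<Sum>a\<in>A. accept_prob n f (T a) * pmf (cond_dist ?D A) a)"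
    using cond_dist_weighted_pmf(2)[of "{1..n}" A "f i"] A f
    by (intro integral_measure_pmf_real) auto
  also have "\<dots> = (\<Sum>a\<in>A. f i a / sum (f i) A * accept_prob n f (T a))"
    using cond_dist_weighted_pmf(1)[of "{1..n}" A "f i"] A f by (intro sum.cong) auto
  finally show ?thesis .
qed

text \<open>The random normaliser \<open>sum u A\<close> is replaced by a constant \<open>M\<close>,
  later the mean of \<open>sum u F\<close>. Weight outside \<open>F\<close> is charged twice, once
  in the normaliser and once in the numerator.\<close>

lemma weighted_average_approx:
  fixes u g :: "'a \<Rightarrow> real"
  assumes "finite A" "A \<noteq> {}" and u: "\<And>a. a \<in> A \<Longrightarrow> 0 < u a"
    and g: "\<And>a. a \<in> A \<Longrightarrow> 0 \<le> g a \<and> g a \<le> 1" and M: "0 < M" and F: "F \<subseteq> A" and e: "0 < e"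
  shows "\<bar>(\<Sum>a\<in>A. u a / sum u A * g a) - (\<Sum>a\<in>F. u a * g a) / M\<bar>
    \<le> e / 2 + (sum u F - M)\<^sup>2 / (2 * e * M\<^sup>2) + 2 * sum u (A - F) / M"
proof -
  define w where "w = sum u A"
  define G where "G = (\<Sum>a\<in>A. u a * g a)"
  have w: "0 < w" using assms by (auto simp: w_def intro!: sum_pos)
  have split: "w = sum u F + sum u (A - F)"
    using assms by (simp add: w_def sum.subset_diff[of F A] add.commute)
  have Gsplit: "G = (\<Sum>a\<in>F. u a * g a) + (\<Sum>a\<in>A - F. u a * g a)"
    using assms by (simp add: G_def sum.subset_diff[of F A] add.commute)
  have le: "u a * g a \<le> u a" "0 \<le> u a * g a" if "a \<in> A" for a
    using u[OF that] g[OF that] by (auto intro: mult_left_le)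
  have G: "0 \<le> G" "G \<le> w" using le by (auto simp: G_def w_def intro!: sum_nonneg sum_mono)
  define H where "H = (\<Sum>a\<in>A - F. u a * g a)"
  have H: "0 \<le> H" "H \<le> sum u (A - F)"
    using le by (auto simp: H_def intro!: sum_nonneg sum_mono)
  have eq: "(\<Sum>a\<in>A. u a / sum u A * g a) - (\<Sum>a\<in>F. u a * g a) / M = G / w - (G - H) / M"
    by (simp add: Gsplit[folded H_def]) (simp add: w_def Gsplit[folded H_def, symmetric] G_def sum_divide_distrib)
  \<comment> \<open>The relative error of the normaliser is multiplied by the average
    \<open>G / w\<close>, which is at most 1; \<open>H / M\<close> is the cost of dropping the
    elements outside \<open>F\<close>.\<close>
  have "G / w - (G - H) / M = (G / w) * ((M - w) / M) + H / M"
    using w M by (simp add: field_simps)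
  also have "\<bar>\<dots>\<bar> \<le> (G / w) * (\<bar>M - w\<bar> / M) + H / M"
    using w M G H by (intro order_trans[OF abs_triangle_ineq]) (simp add: abs_mult)
  also have "\<dots> \<le> 1 * (\<bar>M - w\<bar> / M) + H / M"
    using w M G by (intro add_mono mult_right_mono) auto
  also have "\<dots> \<le> (\<bar>sum u F - M\<bar> + sum u (A - F)) / M + sum u (A - F) / M"
    using M H split by (auto intro!: add_mono divide_right_mono)
  also have "\<dots> = \<bar>sum u F - M\<bar> / M + 2 * sum u (A - F) / M"
    by (simp add: add_divide_distrib)
  also have "\<bar>sum u F - M\<bar> / M \<le> e / 2 + (sum u F - M)\<^sup>2 / (2 * e * M\<^sup>2)"
  proof -
    \<comment> \<open>AM-GM turns the absolute deviation into a square, so that after averaging only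
      a variance is needed.\<close>
    define x where "x = \<bar>sum u F - M\<bar> / M"
    have "0 \<le> (e - x)\<^sup>2" by simp
    then have "2 * e * x \<le> e\<^sup>2 + x\<^sup>2" by (simp add: power2_diff)
    then have "x \<le> e / 2 + x\<^sup>2 / (2 * e)"
      using e by (simp add: field_simps power2_eq_square)
    also have "x\<^sup>2 = (sum u F - M)\<^sup>2 / M\<^sup>2" by (simp add: x_def power_divide)
    finally show ?thesis by (simp add: x_def mult.commute)
  qed
  finally show ?thesis using eq by simp
qed

text \<open>The deviation is a difference of two numbers that both lie between 0 and the weight
  outside \<open>x\<close>, divided by the total weight.\<close>

lemma weighted_average_dominated:
  fixes u g :: "'a \<Rightarrow> real"
  assumes "finite A" and u: "\<And>a. a \<in> A \<Longrightarrow> 0 < u a"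
    and g: "\<And>a. a \<in> A \<Longrightarrow> 0 \<le> g a \<and> g a \<le> 1" and x: "x \<in> A"
  shows "\<bar>(\<Sum>a\<in>A. u a / sum u A * g a) - g x\<bar> \<le> sum u (A - {x}) / u x"
proof -
  define w where "w = sum u A"
  have split: "w = u x + sum u (A - {x})"
    using assms by (simp add: w_def sum.remove)
  have r: "0 \<le> sum u (A - {x})" using u by (intro sum_nonneg) (auto intro: less_imp_le)
  have ux: "0 < u x" using u x by auto
  have w: "0 < w" using split r ux by linarith
  define H where "H = (\<Sum>a\<in>A - {x}. u a * g a)"
  have le: "u a * g a \<le> u a" "0 \<le> u a * g a" if "a \<in> A" for a
    using u[OF that] g[OF that] by (auto intro: mult_left_le)
  have H: "0 \<le> H" "H \<le> sum u (A - {x})"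
    using le by (auto simp: H_def intro!: sum_nonneg sum_mono)
  have "(\<Sum>a\<in>A. u a / sum u A * g a) = (u x * g x + H) / w"
    using assms by (simp add: H_def w_def sum.remove[of A x] sum_divide_distrib add_divide_distrib)
  then have "(\<Sum>a\<in>A. u a / sum u A * g a) - g x = (H - sum u (A - {x}) * g x) / w"
    using w by (simp add: split field_simps)
  moreover have "\<bar>H - sum u (A - {x}) * g x\<bar> \<le> sum u (A - {x})"
  proof -
    have "0 \<le> sum u (A - {x}) * g x" "sum u (A - {x}) * g x \<le> sum u (A - {x})"
      using r g[OF x] by (auto intro: mult_left_le)
    then show ?thesis using H by linarith
  qed
  ultimately have "\<bar>(\<Sum>a\<in>A. u a / sum u A * g a) - g x\<bar> \<le> sum u (A - {x}) / w"
    using w by (simp add: divide_right_mono)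
  also have "\<dots> \<le> sum u (A - {x}) / u x"
    using r ux split by (intro divide_left_mono) auto
  finally show ?thesis .
qed

lemma weighted_average_bounds:
  fixes u g :: "'a \<Rightarrow> real"
  assumes "finite A" "A \<noteq> {}" and u: "\<And>a. a \<in> A \<Longrightarrow> 0 < u a"
    and g: "\<And>a. a \<in> A \<Longrightarrow> 0 \<le> g a \<and> g a \<le> 1"
  shows "0 \<le> (\<Sum>a\<in>A. u a / sum u A * g a)" "(\<Sum>a\<in>A. u a / sum u A * g a) \<le> 1"
proof -
  have w: "0 < sum u A" using assms by (auto intro!: sum_pos)
  show "0 \<le> (\<Sum>a\<in>A. u a / sum u A * g a)"
    using w u g by (intro sum_nonneg mult_nonneg_nonneg divide_nonneg_nonneg) (auto intro: less_imp_le)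
  have "(\<Sum>a\<in>A. u a / sum u A * g a) \<le> (\<Sum>a\<in>A. u a / sum u A)"
    using w u g by (intro sum_mono mult_left_le divide_nonneg_nonneg) (auto intro: less_imp_le)
  also have "\<dots> = 1" using w by (simp flip: sum_divide_distrib)
  finally show "(\<Sum>a\<in>A. u a / sum u A * g a) \<le> 1" .
qed

text \<open>\<open>J\<close> and \<open>c\<close> are the same for all \<open>s\<close>: this allows
  the two sums to be exchanged, so that a bound summed over scales for each fixed continuation
  \<open>j\<close> passes to the mixture.\<close>

lemma sum_abs_diff_mixture:
  fixes Y N :: "'s \<Rightarrow> real" and y z :: "'j \<Rightarrow> 's \<Rightarrow> real"
  assumes "\<And>s. s \<in> S \<Longrightarrow> \<bar>Y s - (\<Sum>j\<in>J. c * y j s)\<bar> \<le> e"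
    and "\<And>s. s \<in> S \<Longrightarrow> \<bar>N s - (\<Sum>j\<in>J. c * z j s)\<bar> \<le> e"
    and c: "0 \<le> c" "c * card J \<le> 1" and b: "0 \<le> b"
    and "\<And>j. j \<in> J \<Longrightarrow> (\<Sum>s\<in>S. \<bar>y j s - z j s\<bar>) \<le> b"
  shows "(\<Sum>s\<in>S. \<bar>Y s - N s\<bar>) \<le> b + 2 * e * card S"
proof -
  have "\<bar>Y s - N s\<bar> \<le> (\<Sum>j\<in>J. c * \<bar>y j s - z j s\<bar>) + 2 * e" if "s \<in> S" for s
  proof -
    have "\<bar>(\<Sum>j\<in>J. c * y j s) - (\<Sum>j\<in>J. c * z j s)\<bar> \<le> (\<Sum>j\<in>J. \<bar>c * y j s - c * z j s\<bar>)"
      unfolding sum_subtractf[symmetric] by (rule sum_abs)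
    also have "\<dots> = (\<Sum>j\<in>J. c * \<bar>y j s - z j s\<bar>)"
      using c by (intro sum.cong) (auto simp: abs_mult simp flip: right_diff_distrib)
    finally show ?thesis using assms(1,2)[OF that] by linarith
  qed
  then have "(\<Sum>s\<in>S. \<bar>Y s - N s\<bar>) \<le> (\<Sum>s\<in>S. (\<Sum>j\<in>J. c * \<bar>y j s - z j s\<bar>) + 2 * e)"
    by (rule sum_mono)
  also have "\<dots> = (\<Sum>j\<in>J. c * (\<Sum>s\<in>S. \<bar>y j s - z j s\<bar>)) + 2 * e * card S"
    by (simp add: sum.distrib sum_distrib_left sum.swap[of _ J S])
  also have "(\<Sum>j\<in>J. c * (\<Sum>s\<in>S. \<bar>y j s - z j s\<bar>)) \<le> (\<Sum>j\<in>J. c * b)"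
    using assms by (intro sum_mono mult_left_mono) auto
  also have "\<dots> \<le> b" using c b mult_right_mono[OF c(2) b] by (simp add: mult_ac)
  finally show ?thesis by simp
qed

text \<open>The differences sum to 0, so the gain on \<open>A\<close> reappears as a loss on its
  complement and the absolute sum is at least twice the gain.\<close>

lemma tv_dist_ge_event:
  assumes "dist_on n D1" "dist_on n D2" "A \<subseteq> {1..n}"
  shows "tv_dist n D1 D2 \<ge> (\<Sum>x\<in>A. pmf D1 x) - (\<Sum>x\<in>A. pmf D2 x)"
proof -
  have *: "(\<Sum>x\<in>{1..n}. pmf D x) = 1" if "dist_on n D" for D
    using that by (intro sum_pmf_eq_1) (auto simp: dist_on_def)
  let ?d = "\<lambda>x. pmf D1 x - pmf D2 x"
  have "(\<Sum>x\<in>{1..n}. ?d x) = 0" using *[OF assms(1)] *[OF assms(2)] by (simp add: sum_subtractf)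
  then have "(\<Sum>x\<in>A. ?d x) + (\<Sum>x\<in>{1..n} - A. ?d x) = 0"
    using sum.subset_diff[of A "{1..n}" ?d] assms(3) by (simp add: add.commute)
  then have "2 * (\<Sum>x\<in>A. ?d x) = (\<Sum>x\<in>A. ?d x) + (\<Sum>x\<in>{1..n} - A. - ?d x)"
    by (simp only: sum_negf)
  also have "\<dots> \<le> (\<Sum>x\<in>A. \<bar>?d x\<bar>) + (\<Sum>x\<in>{1..n} - A. \<bar>?d x\<bar>)"
    by (intro add_mono sum_mono) auto
  also have "\<dots> = (\<Sum>x\<in>{1..n}. \<bar>?d x\<bar>)"
    using sum.subset_diff[of A "{1..n}" "\<lambda>x. \<bar>?d x\<bar>"] assms(3) by (simp add: add.commute)
  finally show ?thesis by (simp add: tv_dist_def sum_subtractf)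
qed

section \<open>The hard instances\<close>

text \<open>The query budget fixes the number of levels: an error of
  \<open>(q + 30) / (r + 1)\<close> per query stays below 1/100 in total over \<open>q\<close>
  queries. The 30 absorbs the constants of the approximations below.\<close>

locale level_hierarchy =
  fixes n q r :: nat
  assumes r: "r + 1 = 100 * (q + 30)\<^sup>2"
begin

text \<open>The number of levels including the bottom one. It is also the mean weight of an unseen
  element, as each level contributes 1.\<close>

definition R :: real where "R = real r + 1"

definition B :: real where "B = R\<^sup>2"

text \<open>Above the bottom, the exponents at scale \<open>s\<close> run from
  \<open>(s + 1) * (r + 1)\<close> down to \<open>s * (r + 1) + 2\<close>, so the ranges of
  different scales are disjoint. The bottom weight is the reciprocal of the leftover probability,
  which makes probability times weight equal 1 there too.\<close>

definition W :: "nat \<Rightarrow> nat \<Rightarrow> real" where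
  "W s l = (if l < r then B ^ ((s + 1) * (r + 1) - l)
            else 1 / (1 - (\<Sum>l<r. 1 / B ^ ((s + 1) * (r + 1) - l))))"

text \<open>The exponent falls in the gap between two scales: \<open>threshold s\<close> is at least
  a factor \<open>B\<close> below all non-bottom weights of scale \<open>s\<close>, and
  \<open>threshold (Suc s)\<close> a factor \<open>B\<close> above the largest one.\<close>

definition threshold :: "nat \<Rightarrow> real" where
  "threshold s = B ^ (s * (r + 1) + 1)"

lemma R_eq: "R = 100 * (real q + 30)\<^sup>2"
proof -
  have "R = real (r + 1)" by (simp add: R_def)
  then show ?thesis by (simp only: r) simp
qed

lemma R_ge: "3000 * (real q + 30) \<le> R" "90000 \<le> R"
proof -
  show *: "3000 * (real q + 30) \<le> R"
    by (simp add: R_eq power2_eq_square algebra_simps)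
  show "90000 \<le> R" using * by simp
qed

lemma B_ge: "R \<le> B" "90000 * R \<le> B" "90000 \<le> B" "1 \<le> B" "0 < B"
proof -
  show *: "90000 * R \<le> B"
    using R_ge(2) mult_right_mono[of 90000 R R] by (simp add: B_def power2_eq_square)
  show "R \<le> B" "90000 \<le> B" "1 \<le> B" "0 < B" using * R_ge(2) by auto
qed

lemma r_pos: "0 < r"
  using R_ge(2) by (auto simp: R_def intro: ccontr)

section \<open>Separation of levels and scales\<close>

lemma threshold_mono: "s \<le> s' \<Longrightarrow> threshold s \<le> threshold s'"
  unfolding threshold_def using B_ge by (intro power_increasing add_right_mono mult_right_mono) auto

lemma threshold_mult_B_le_W:
  assumes "l < r" shows "threshold s * B \<le> W s l"
proof -
  have "s * (r + 1) + 2 \<le> (s + 1) * (r + 1) - l" using assms by simp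
  then have "B ^ (s * (r + 1) + 2) \<le> W s l"
    using assms B_ge(4) by (simp only: W_def if_True power_increasing)
  then show ?thesis by (simp add: threshold_def mult_ac)
qed

lemma B_le_threshold: "B \<le> threshold s"
  using power_increasing[of 1 "s * (r + 1) + 1" B] B_ge by (simp add: threshold_def)

text \<open>The left side is the probability that an unseen element lies above the bottom level, as
  needed for a union bound over small sets.\<close>

lemma sum_inverse_W_le:
  "(\<Sum>l<r. 1 / W s l) \<le> real r / (threshold s * B)"
proof -
  have pos: "0 < threshold s" "0 < B" using B_le_threshold[of s] B_ge by auto
  then have "0 < threshold s * B" by simp
  with pos have "(\<Sum>l<r. 1 / W s l) \<le> (\<Sum>l<r. 1 / (threshold s * B))"
    using threshold_mult_B_le_W[of _ s]
    by (intro sum_mono divide_left_mono mult_pos_pos) (auto intro: less_le_trans[of 0 "threshold s * B"])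
  then show ?thesis by simp
qed

lemma sum_inverse_W_le_half: "(\<Sum>l<r. 1 / W s l) \<le> 1 / 2"
proof -
  have "real r \<le> B" using B_ge by (simp add: R_def)
  moreover have "2 \<le> threshold s" using B_le_threshold[of s] B_ge by simp
  ultimately have "real r / (threshold s * B) \<le> B / (2 * B)"
    using B_ge by (intro frac_le mult_right_mono) auto
  also have "B / (2 * B) = 1 / 2" using B_ge(5) by simp
  finally show ?thesis using sum_inverse_W_le[of s] by (rule order_trans[rotated])
qed

lemma W_bottom: "r \<le> l \<Longrightarrow> W s l = 1 / (1 - (\<Sum>l<r. 1 / W s l))"
  by (simp add: W_def)

lemma sum_inverse_W_nonneg: "0 \<le> (\<Sum>l<r. 1 / W s l)"
  using B_ge by (intro sum_nonneg) (auto simp: W_def)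

lemma W_bottom_bounds:
  assumes "r \<le> l" shows "1 \<le> W s l" "W s l \<le> 2"
  using sum_inverse_W_le_half[of s] sum_inverse_W_nonneg[of s]
  by (auto simp: W_bottom[OF assms] field_simps)

lemma W_pos: "0 < W s l"
proof (cases "l < r")
  case True then show ?thesis using B_ge by (simp add: W_def)
next
  case False then show ?thesis using W_bottom_bounds(1)[of l s] by simp
qed

lemma W_top: "W s 0 * B = threshold (Suc s)"
  using r_pos by (simp add: W_def threshold_def mult_ac)

lemma W_le_top: "W s l \<le> W s 0"
proof (cases "l < r")
  case True
  then show ?thesis using B_ge(4) by (simp only: W_def if_True r_pos) (intro power_increasing, auto)
next
  case False
  have "2 * B \<le> threshold s * B" using B_le_threshold[of s] B_ge by (intro mult_right_mono) auto
  also have "\<dots> \<le> W s 0" using threshold_mult_B_le_W r_pos by simp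
  finally show ?thesis using W_bottom_bounds(2)[of l s] False B_ge by simp
qed

lemma W_separated:
  assumes "l < l'" "l' < r" shows "B * W s l' \<le> W s l"
proof -
  have "B * W s l' = B ^ Suc ((s + 1) * (r + 1) - l')" using assms by (simp add: W_def)
  also have "\<dots> \<le> B ^ ((s + 1) * (r + 1) - l)"
    using assms B_ge(4) by (intro power_increasing) auto
  also have "\<dots> = W s l" using assms by (simp add: W_def)
  finally show ?thesis .
qed

lemma sum_inverse_W: "(\<Sum>l\<le>r. 1 / W s l) = 1"
  using W_bottom[of r s] by (simp add: lessThan_Suc_atMost[symmetric])

section \<open>Laws of the type of a single element\<close>

definition base :: "nat \<Rightarrow> (nat \<times> bool) pmf" where
  "base s = pair_pmf (weighted_pmf {..r} (\<lambda>l. 1 / W s l)) (bernoulli_pmf (1 / 2))"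

lemma pmf_base: "pmf (base s) (l, b) = (if l \<le> r then 1 / (2 * W s l) else 0)"
  unfolding base_def pmf_pair
  using W_pos[of s] by (subst pmf_weighted_pmf) (auto simp: sum_inverse_W)

lemma set_base: "set_pmf (base s) \<subseteq> {..r} \<times> UNIV"
  by (auto simp: set_pmf_iff pmf_base split: if_splits)

lemma finite_base: "finite (set_pmf (base s))"
  by (rule finite_subset[OF set_base]) auto

lemma expectation_base:
  "measure_pmf.expectation (base s) h = (\<Sum>l\<le>r. (h (l, True) + h (l, False)) / (2 * W s l))"
proof -
  have "measure_pmf.expectation (base s) h = (\<Sum>t\<in>{..r} \<times> UNIV. h t * pmf (base s) t)"
    using set_base by (intro integral_measure_pmf_real) auto
  also have "\<dots> = (\<Sum>l\<le>r. \<Sum>b\<in>UNIV. h (l, b) * pmf (base s) (l, b))"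
    by (simp add: sum.cartesian_product)
  also have "\<dots> = (\<Sum>l\<le>r. (h (l, True) + h (l, False)) / (2 * W s l))"
    by (intro sum.cong) (auto simp: pmf_base UNIV_bool add_divide_distrib)
  finally show ?thesis .
qed

text \<open>A tilt is the sign-dependent factor by which the weights of one side are multiplied; it
  preserves the expected weight of every level and ignores the bottom level.\<close>

definition tilt :: "(side \<Rightarrow> nat \<times> bool \<Rightarrow> real) \<Rightarrow> bool" where
  "tilt \<kappa> \<longleftrightarrow> (\<forall>i t. 1 / 10 \<le> \<kappa> i t \<and> \<kappa> i t \<le> 2) \<and>
     (\<forall>i l. \<kappa> i (l, True) + \<kappa> i (l, False) = 2) \<and> (\<forall>i l b. r \<le> l \<longrightarrow> \<kappa> i (l, b) = 1)"

lemma tiltD: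
  assumes "tilt \<kappa>"
  shows "1 / 10 \<le> \<kappa> i t" "0 < \<kappa> i t" "\<kappa> i t \<le> 2" "\<kappa> i (l, True) + \<kappa> i (l, False) = 2"
    "r \<le> l \<Longrightarrow> \<kappa> i (l, b) = 1"
proof -
  show *: "1 / 10 \<le> \<kappa> i t" "\<kappa> i t \<le> 2" "\<kappa> i (l, True) + \<kappa> i (l, False) = 2"
    "r \<le> l \<Longrightarrow> \<kappa> i (l, b) = 1"
    using assms unfolding tilt_def by blast+
  show "0 < \<kappa> i t" using *(1) by linarith
qed

definition weight :: "(side \<Rightarrow> nat \<times> bool \<Rightarrow> real) \<Rightarrow> nat \<Rightarrow> side \<Rightarrow> nat \<times> bool \<Rightarrow> real" where
  "weight \<kappa> s i t = W s (fst t) * \<kappa> i t"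

lemma weight_pos: "tilt \<kappa> \<Longrightarrow> 0 < weight \<kappa> s i t"
  by (simp add: weight_def W_pos tiltD)

lemma weight_le: "tilt \<kappa> \<Longrightarrow> weight \<kappa> s i t \<le> 2 * W s (fst t)"
  using mult_left_mono[OF tiltD(3)[of \<kappa> i t] less_imp_le[OF W_pos[of s "fst t"]]]
  by (simp add: weight_def mult_ac)

lemma weight_ge: "tilt \<kappa> \<Longrightarrow> W s (fst t) / 10 \<le> weight \<kappa> s i t"
  using mult_left_mono[OF tiltD(1)[of \<kappa> i t] less_imp_le[OF W_pos[of s "fst t"]]]
  by (simp add: weight_def mult_ac)

text \<open>The tilts of the two signs add up to 2, so each level contributes exactly 1 whatever the
  tilt: mean weights do not separate the equal from the far pair.\<close>

lemma expectation_weight: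
  assumes "tilt \<kappa>" shows "measure_pmf.expectation (base s) (weight \<kappa> s i) = R"
proof -
  have "(weight \<kappa> s i (l, True) + weight \<kappa> s i (l, False)) / (2 * W s l) = 1" for l
    using W_pos[of s l] tiltD(4)[OF assms, of i l]
    by (simp add: weight_def distrib_left[symmetric])
  then have "(\<Sum>l\<le>r. (weight \<kappa> s i (l, True) + weight \<kappa> s i (l, False)) / (2 * W s l)) =
      (\<Sum>l\<le>r. 1)"
    by (intro sum.cong refl)
  then show ?thesis by (simp add: expectation_base R_def)
qed

text \<open>One factor of the square cancels, up to a constant, against the probability of the
  level; the other is at most \<open>2 * W s 0\<close>. So each of the \<open>R\<close> levels
  contributes at most \<open>4 * W s 0\<close>.\<close>

lemma expectation_weight_square:
  assumes "tilt \<kappa>"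
  shows "measure_pmf.expectation (base s) (\<lambda>t. (weight \<kappa> s i t - R)\<^sup>2) \<le> 4 * R * W s 0"
proof -
  note int = integrable_measure_pmf_finite[OF finite_base]
  have "measure_pmf.expectation (base s) (\<lambda>t. (weight \<kappa> s i t - R)\<^sup>2) =
      measure_pmf.expectation (base s) (\<lambda>t. (weight \<kappa> s i t)\<^sup>2 - 2 * R * weight \<kappa> s i t + R\<^sup>2)"
    by (simp add: power2_diff algebra_simps)
  also have "\<dots> = measure_pmf.expectation (base s) (\<lambda>t. (weight \<kappa> s i t)\<^sup>2) - R\<^sup>2"
    using expectation_weight[OF assms] by (simp add: int power2_eq_square)
  also have "\<dots> \<le> measure_pmf.expectation (base s) (\<lambda>t. (weight \<kappa> s i t)\<^sup>2)" by simp
  also have "\<dots> \<le> (\<Sum>l\<le>r. 4 * W s 0)"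
    unfolding expectation_base
  proof (rule sum_mono)
    fix l
    have "(weight \<kappa> s i (l, b))\<^sup>2 \<le> (2 * W s l) * (2 * W s 0)" for b
      unfolding power2_eq_square
      using weight_le[OF assms, of s i "(l, b)"] W_le_top[of s l]
        weight_pos[OF assms, of s i "(l, b)"] W_pos[of s]
      by (intro mult_mono) (auto intro: less_imp_le)
    from add_mono[OF this[of True] this[of False]]
    show "((weight \<kappa> s i (l, True))\<^sup>2 + (weight \<kappa> s i (l, False))\<^sup>2) / (2 * W s l) \<le> 4 * W s 0"
      using W_pos[of s l] by (simp add: field_simps)
  qed
  also have "\<dots> = 4 * R * W s 0" by (simp add: R_def)
  finally show ?thesis .
qed

text \<open>The type of an element once a draw through side \<open>i\<close> has revealed its level
  \<open>l\<close>: being drawn biases the sign in proportion to the tilt.\<close>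

definition level_pmf :: "(side \<Rightarrow> nat \<times> bool \<Rightarrow> real) \<Rightarrow> side \<Rightarrow> nat \<Rightarrow> (nat \<times> bool) pmf" where
  "level_pmf \<kappa> i l = map_pmf (Pair l) (bernoulli_pmf (\<kappa> i (l, True) / 2))"

lemma set_level_pmf: "set_pmf (level_pmf \<kappa> i l) \<subseteq> {l} \<times> UNIV"
  by (auto simp: level_pmf_def)

lemma finite_level_pmf: "finite (set_pmf (level_pmf \<kappa> i l))"
  by (rule finite_subset[OF set_level_pmf]) auto

lemma pmf_level_pmf:
  assumes "tilt \<kappa>" shows "pmf (level_pmf \<kappa> i l) (l, b) = \<kappa> i (l, b) / 2"
proof -
  have "pmf (level_pmf \<kappa> i l) (l, b) = pmf (bernoulli_pmf (\<kappa> i (l, True) / 2)) b"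
    unfolding level_pmf_def by (rule pmf_map_inj') (auto simp: inj_def)
  moreover have "\<kappa> i (l, False) = 2 - \<kappa> i (l, True)" using tiltD(4)[OF assms, of i l] by simp
  ultimately show ?thesis
    using tiltD(2,3)[OF assms, of i "(l, True)"] by (cases b) (auto simp: diff_divide_distrib)
qed

definition types :: "(nat \<Rightarrow> (nat \<times> bool) pmf) \<Rightarrow> (nat \<Rightarrow> nat \<times> bool) pmf" where
  "types m = Pi_pmf {1..n} undefined m"

abbreviation E :: "(nat \<Rightarrow> (nat \<times> bool) pmf) \<Rightarrow> ((nat \<Rightarrow> nat \<times> bool) \<Rightarrow> real) \<Rightarrow> real" where
  "E m \<equiv> measure_pmf.expectation (types m)"

text \<open>Since every level carries the same expected weight, weighting the prior of an element by its
  weight makes its level uniform.\<close>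

lemma expectation_weight_mult:
  assumes \<kappa>: "tilt \<kappa>" and a: "a \<in> {1..n}" "m a = base s"
    and fin: "\<And>x. finite (set_pmf (m x))"
  shows "E m (\<lambda>\<tau>. weight \<kappa> s i (\<tau> a) * g \<tau>) = (\<Sum>l\<le>r. E (m(a := level_pmf \<kappa> i l)) g)"
proof -
  let ?G = "\<lambda>t. E (m(a := return_pmf t)) g"
  have "E m (\<lambda>\<tau>. weight \<kappa> s i (\<tau> a) * g \<tau>) =
      (\<Sum>t\<in>{..r} \<times> UNIV. pmf (base s) t * weight \<kappa> s i t * ?G t)"
    using a fin set_base unfolding types_def by (subst expectation_Pi_pmf_mult_component[where S = "{..r} \<times> UNIV"]) auto
  also have "\<dots> = (\<Sum>l\<le>r. \<Sum>b\<in>UNIV. pmf (base s) (l, b) * weight \<kappa> s i (l, b) * ?G (l, b))"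
    by (simp add: sum.cartesian_product)
  also have "\<dots> = (\<Sum>l\<le>r. \<Sum>b\<in>UNIV. \<kappa> i (l, b) / 2 * ?G (l, b))"
    using W_pos[of s] by (intro sum.cong refl) (auto simp: pmf_base weight_def less_imp_neq[THEN not_sym])
  also have "\<dots> = (\<Sum>l\<le>r. E (m(a := level_pmf \<kappa> i l)) g)"
  proof (rule sum.cong[OF refl])
    fix l
    have "E (m(a := level_pmf \<kappa> i l)) (\<lambda>\<tau>. 1 * g \<tau>) =
        (\<Sum>t\<in>{l} \<times> UNIV. pmf (level_pmf \<kappa> i l) t * 1 * E ((m(a := level_pmf \<kappa> i l))(a := return_pmf t)) g)"
      using a fin set_level_pmf[of \<kappa> i l] finite_level_pmf
      unfolding types_def by (subst expectation_Pi_pmf_mult_component[where S = "{l} \<times> UNIV" and h = "\<lambda>_. 1"]) auto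
    also have "\<dots> = (\<Sum>b\<in>UNIV. pmf (level_pmf \<kappa> i l) (l, b) * ?G (l, b))"
    proof -
      have eq: "{l} \<times> UNIV = range (Pair l :: bool \<Rightarrow> _)" by auto
      show ?thesis unfolding eq by (subst sum.reindex) (auto simp: inj_on_def)
    qed
    finally show "(\<Sum>b\<in>UNIV. \<kappa> i (l, b) / 2 * ?G (l, b)) = E (m(a := level_pmf \<kappa> i l)) g"
      by (simp add: pmf_level_pmf[OF \<kappa>])
  qed
  finally show ?thesis .
qed

section \<open>Answers to a query\<close>

lemma finite_prior: "(\<And>x. finite (set_pmf (m x))) \<Longrightarrow> finite (set_pmf (types m))"
  unfolding types_def by (intro finite_set_Pi_pmf) auto

lemma types_component: "\<tau> \<in> set_pmf (types m) \<Longrightarrow> a \<in> {1..n} \<Longrightarrow> \<tau> a \<in> set_pmf (m a)"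
  by (auto simp: types_def set_Pi_pmf PiE_dflt_def)

lemma E_component: "a \<in> {1..n} \<Longrightarrow> E m (\<lambda>\<tau>. h (\<tau> a)) = measure_pmf.expectation (m a) h"
  unfolding types_def by (rule expectation_Pi_pmf_component) auto

text \<open>With \<open>g a\<close> the acceptance probability of the continuation after answer
  \<open>a\<close>, this is the acceptance probability of the query for fixed types.\<close>

definition answer ::
  "(side \<Rightarrow> nat \<times> bool \<Rightarrow> real) \<Rightarrow> nat \<Rightarrow> side \<Rightarrow> nat set \<Rightarrow>
   (nat \<Rightarrow> (nat \<Rightarrow> nat \<times> bool) \<Rightarrow> real) \<Rightarrow> (nat \<Rightarrow> nat \<times> bool) \<Rightarrow> real" where
  "answer \<kappa> s i A g \<tau> =
     (\<Sum>a\<in>A. weight \<kappa> s i (\<tau> a) / (\<Sum>b\<in>A. weight \<kappa> s i (\<tau> b)) * g a \<tau>)"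

text \<open>The total weight of \<open>F\<close> concentrates around its mean
  \<open>card F * R\<close> by a variance bound, and the at most \<open>q\<close> other elements are
  negligible since \<open>card F\<close> exceeds the largest untilted weight by a factor
  \<open>B\<close>.\<close>

lemma answer_large_fresh:
  assumes \<kappa>: "tilt \<kappa>" and A: "A \<subseteq> {1..n}" "F \<subseteq> A" "card (A - F) \<le> q"
    and m: "\<And>x. x \<in> F \<Longrightarrow> m x = base s" "\<And>x. finite (set_pmf (m x))"
    and F: "threshold (Suc s) \<le> card F"
    and g: "\<And>a \<tau>. 0 \<le> g a \<tau> \<and> g a \<tau> \<le> 1"
  shows "\<bar>E m (answer \<kappa> s i A g) - (\<Sum>a\<in>F. E m (\<lambda>\<tau>. weight \<kappa> s i (\<tau> a) * g a \<tau>)) / (card F * R)\<bar>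
    \<le> 4 / R"
proof -
  define M where "M = card F * R"
  \<comment> \<open>With this \<open>e\<close> the variance term becomes
    \<open>2 * W s 0 / card F\<close>, at most \<open>2 / R\<close>; the remaining terms are at most
    \<open>e / 2 + 1 / R\<close>.\<close>
  define e where "e = 1 / R"
  note fin = finite_prior[OF m(2)]
  note int = integrable_measure_pmf_finite[OF fin]
  have finA: "finite A" "finite F" using A by (auto intro: finite_subset)
  have F_B: "B * W s 0 \<le> card F" using F W_top[of s] by (simp add: mult.commute)
  have W0: "0 < W s 0" by (rule W_pos)
  have cF: "0 < real (card F)"
    using F_B B_ge W0 by (meson less_le_trans mult_pos_pos)
  have R: "0 < R" using R_ge by simp
  have M: "0 < M" using cF R by (simp add: M_def)
  have ne: "A \<noteq> {}" using cF A by auto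
  define D where "D = 1 / (2 * e * M\<^sup>2)"
  define C where "C = e / 2 + 2 * (q * (2 * W s 0)) / M"
  let ?h = "\<lambda>t. weight \<kappa> s i t - R"
  have point: "\<bar>answer \<kappa> s i A g \<tau> - (\<Sum>a\<in>F. weight \<kappa> s i (\<tau> a) * g a \<tau>) / M\<bar>
      \<le> C + D * (\<Sum>a\<in>F. ?h (\<tau> a))\<^sup>2" for \<tau>
  proof -
    have "\<bar>answer \<kappa> s i A g \<tau> - (\<Sum>a\<in>F. weight \<kappa> s i (\<tau> a) * g a \<tau>) / M\<bar>
        \<le> e / 2 + ((\<Sum>a\<in>F. weight \<kappa> s i (\<tau> a)) - M)\<^sup>2 / (2 * e * M\<^sup>2)
          + 2 * (\<Sum>a\<in>A - F. weight \<kappa> s i (\<tau> a)) / M"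
      unfolding answer_def
      using finA ne A M R weight_pos[OF \<kappa>] g by (intro weighted_average_approx) (auto simp: e_def)
    moreover have "(\<Sum>a\<in>F. weight \<kappa> s i (\<tau> a)) - M = (\<Sum>a\<in>F. ?h (\<tau> a))"
      by (simp add: sum_subtractf M_def)
    moreover have "(\<Sum>a\<in>A - F. weight \<kappa> s i (\<tau> a)) \<le> q * (2 * W s 0)"
    proof -
      have "(\<Sum>a\<in>A - F. weight \<kappa> s i (\<tau> a)) \<le> (\<Sum>a\<in>A - F. 2 * W s 0)"
        using weight_le[OF \<kappa>, of s i] W_le_top[of s]
        by (intro sum_mono) (meson mult_left_mono order_trans zero_le_numeral)
      also have "\<dots> \<le> q * (2 * W s 0)" using A(3) W0 by simp
      finally show ?thesis .
    qed
    then have "2 * (\<Sum>a\<in>A - F. weight \<kappa> s i (\<tau> a)) / M \<le> 2 * (q * (2 * W s 0)) / M"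
      using M by (intro divide_right_mono) auto
    ultimately show ?thesis by (simp add: C_def D_def)
  qed
  have eq: "(\<Sum>a\<in>F. E m (\<lambda>\<tau>. weight \<kappa> s i (\<tau> a) * g a \<tau>)) / M =
      E m (\<lambda>\<tau>. (\<Sum>a\<in>F. weight \<kappa> s i (\<tau> a) * g a \<tau>) / M)"
    by (simp add: int Bochner_Integration.integral_sum)
  have "\<bar>E m (answer \<kappa> s i A g) - (\<Sum>a\<in>F. E m (\<lambda>\<tau>. weight \<kappa> s i (\<tau> a) * g a \<tau>)) / M\<bar>
      \<le> E m (\<lambda>\<tau>. C + D * (\<Sum>a\<in>F. ?h (\<tau> a))\<^sup>2)"
    unfolding eq by (rule abs_expectation_diff_le[OF fin point])
  also have "\<dots> = C + D * E m (\<lambda>\<tau>. (\<Sum>a\<in>F. ?h (\<tau> a))\<^sup>2)"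
    by (simp add: int)
  also have "E m (\<lambda>\<tau>. (\<Sum>a\<in>F. ?h (\<tau> a))\<^sup>2) =
      card F * measure_pmf.expectation (base s) (\<lambda>t. (?h t)\<^sup>2)"
    using A m expectation_weight[OF \<kappa>, of s i]
    unfolding types_def by (intro variance_sum_Pi_pmf) (auto simp: integrable_measure_pmf_finite[OF finite_base])
  also have "C + D * (card F * measure_pmf.expectation (base s) (\<lambda>t. (?h t)\<^sup>2))
      \<le> C + D * (card F * (4 * R * W s 0))"
    using expectation_weight_square[OF \<kappa>, of s i] R
    by (intro add_left_mono mult_left_mono) (auto simp: D_def e_def)
  also have "D * (card F * (4 * R * W s 0)) = 2 * W s 0 / card F"
    using cF R by (simp add: D_def e_def M_def field_simps power2_eq_square)
  also have "\<dots> \<le> 2 * W s 0 / (B * W s 0)"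
    using F_B W0 B_ge by (intro divide_left_mono mult_pos_pos cF) auto
  also have "\<dots> = 2 / B" using W0 by simp
  also have "\<dots> \<le> 2 / R" using B_ge R by (intro divide_left_mono) auto
  also have "C \<le> e / 2 + 1 / R"
  proof -
    have "2 * (q * (2 * W s 0)) / M = (4 * q * W s 0 / card F) / R"
      using R cF by (simp add: M_def field_simps)
    also have "4 * q * W s 0 / card F \<le> 4 * q * W s 0 / (B * W s 0)"
      using F_B W0 B_ge by (intro divide_left_mono mult_pos_pos cF) auto
    also have "\<dots> = 4 * q / B" using W0 by simp
    also have "\<dots> \<le> 1" using B_ge R_ge by simp
    finally show ?thesis using R by (simp add: C_def divide_right_mono)
  qed
  finally show ?thesis using R by (simp add: e_def M_def field_simps)
qed

text \<open>The elements of \<open>X\<close> have been drawn and their levels \<open>lv\<close> revealed; nothing is assumed about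
  the distribution of their signs, which may therefore differ between the equal and the far pair.\<close>

definition prior :: "nat \<Rightarrow> nat set \<Rightarrow> (nat \<Rightarrow> nat) \<Rightarrow> (nat \<Rightarrow> (nat \<times> bool) pmf) \<Rightarrow> bool" where
  "prior s X lv m \<longleftrightarrow>
     (\<forall>x\<in>X. set_pmf (m x) \<subseteq> {lv x} \<times> UNIV) \<and> (\<forall>x. x \<notin> X \<longrightarrow> m x = base s)"

lemma prior_finite:
  assumes "prior s X lv m" shows "finite (set_pmf (m x))"
proof (cases "x \<in> X")
  case True
  then have "set_pmf (m x) \<subseteq> {lv x} \<times> UNIV" using assms by (auto simp: prior_def)
  then show ?thesis by (rule finite_subset) auto
next
  case False then show ?thesis using assms finite_base by (simp add: prior_def)
qed

lemma prior_extend: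
  "prior s X lv m \<Longrightarrow> prior s (insert a X) (lv(a := l)) (m(a := level_pmf \<kappa> i l))"
  using set_level_pmf[of \<kappa> i l] by (auto simp: prior_def)

lemma expectation_bounds:
  assumes "\<And>\<tau>. 0 \<le> g \<tau> \<and> g \<tau> \<le> 1" "\<And>x. finite (set_pmf (m x))"
  shows "0 \<le> E m g" "E m g \<le> 1"
proof -
  show "0 \<le> E m g" using assms by simp
  have "E m g \<le> E m (\<lambda>_. 1)" using assms by (intro expectation_mono_finite finite_prior) auto
  then show "E m g \<le> 1" by simp
qed

lemma answer_large:
  assumes \<kappa>: "tilt \<kappa>" and A: "A \<subseteq> {1..n}" and m: "prior s X lv m"
    and X: "finite X" "card X \<le> q" and F: "threshold (Suc s) \<le> card (A - X)"
    and g: "\<And>a \<tau>. 0 \<le> g a \<tau> \<and> g a \<tau> \<le> 1"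
  shows "\<bar>E m (answer \<kappa> s i A g) -
      (\<Sum>(a, l)\<in>(A - X) \<times> ({..<r} - lv ` X). 1 / (card (A - X) * R) * E (m(a := level_pmf \<kappa> i l)) (g a))\<bar>
    \<le> (q + 30) / R"
proof -
  define F where "F = A - X"
  define L where "L = {..<r} - lv ` X"
  let ?G = "\<lambda>a l. E (m(a := level_pmf \<kappa> i l)) (g a)"
  have finA: "finite A" "finite F" using A by (auto simp: F_def intro: finite_subset)
  have R: "0 < R" using R_ge by simp
  have cF: "0 < real (card F)" using assms(6) B_le_threshold[of "Suc s"] B_ge by (simp add: F_def)
  have "card (A - F) \<le> q"
    using X card_mono[OF X(1), of "A - F"] by (force simp: F_def)
  with assms have 1: "\<bar>E m (answer \<kappa> s i A g) -
      (\<Sum>a\<in>F. E m (\<lambda>\<tau>. weight \<kappa> s i (\<tau> a) * g a \<tau>)) / (card F * R)\<bar> \<le> 4 / R"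
    by (intro answer_large_fresh prior_finite[OF m]) (auto simp: F_def prior_def)
  have "E m (\<lambda>\<tau>. weight \<kappa> s i (\<tau> a) * g a \<tau>) = (\<Sum>l\<le>r. ?G a l)" if "a \<in> F" for a
    using that A m by (intro expectation_weight_mult[OF \<kappa>] prior_finite[OF m]) (auto simp: F_def prior_def)
  then have 2: "(\<Sum>a\<in>F. E m (\<lambda>\<tau>. weight \<kappa> s i (\<tau> a) * g a \<tau>)) = (\<Sum>a\<in>F. \<Sum>l\<le>r. ?G a l)"
    by (intro sum.cong refl)
  \<comment> \<open>The dropped levels are the bottom one and at most \<open>q\<close> levels of
    elements of \<open>X\<close>, each contributing at most 1.\<close>
  have diff: "\<bar>(\<Sum>l\<le>r. ?G a l) - (\<Sum>l\<in>L. ?G a l)\<bar> \<le> q + 1" for a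
  proof -
    have G: "0 \<le> ?G a l" "?G a l \<le> 1" for l
      using g prior_finite[OF m] finite_level_pmf by (auto intro!: expectation_bounds)
    have "(\<Sum>l\<le>r. ?G a l) = (\<Sum>l\<in>{..r} - L. ?G a l) + (\<Sum>l\<in>L. ?G a l)"
      by (intro sum.subset_diff) (auto simp: L_def)
    moreover have "(\<Sum>l\<in>{..r} - L. ?G a l) \<le> (\<Sum>l\<in>{..r} - L. 1)"
      using G by (intro sum_mono) auto
    moreover have "card ({..r} - L) \<le> card (insert r (lv ` X))"
      using X by (intro card_mono) (auto simp: L_def)
    moreover have "card (insert r (lv ` X)) \<le> q + 1"
      using card_insert_le_m1[of "q + 1" "lv ` X" r] card_image_le[OF X(1), of lv] X(2) by simp
    moreover have "0 \<le> (\<Sum>l\<in>{..r} - L. ?G a l)" using G by (intro sum_nonneg) auto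
    ultimately show ?thesis by simp
  qed
  have "\<bar>(\<Sum>a\<in>F. \<Sum>l\<le>r. ?G a l) - (\<Sum>a\<in>F. \<Sum>l\<in>L. ?G a l)\<bar> \<le> (\<Sum>a\<in>F. q + 1)"
    unfolding sum_subtractf[of _ _ F, symmetric] of_nat_sum
    by (intro order_trans[OF sum_abs] sum_mono diff)
  then have 3: "\<bar>(\<Sum>a\<in>F. \<Sum>l\<le>r. ?G a l) / (card F * R) - (\<Sum>a\<in>F. \<Sum>l\<in>L. ?G a l) / (card F * R)\<bar>
      \<le> (q + 1) / R"
    using cF R by (simp add: diff_divide_distrib[symmetric] abs_divide field_simps)
  have 4: "(\<Sum>(a, l)\<in>F \<times> L. 1 / (card F * R) * ?G a l) = (\<Sum>a\<in>F. \<Sum>l\<in>L. ?G a l) / (card F * R)"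
    by (simp add: sum.cartesian_product[symmetric] sum_divide_distrib)
  have "4 / R + (q + 1) / R \<le> (q + 30) / R" using R by (simp add: field_simps)
  moreover have "\<bar>a - c\<bar> \<le> z" if "\<bar>a - b\<bar> \<le> x" "\<bar>b - c\<bar> \<le> y" "x + y \<le> z" for a b c x y z :: real
    using that by linarith
  ultimately show ?thesis
    using 1 3 unfolding F_def[symmetric] L_def[symmetric] 4 2 by blast
qed

text \<open>The drawn element of least level outweighs everything else: other drawn elements by a
  factor of order \<open>B\<close> because levels are distinct, the unseen ones because their total
  mean weight is at most \<open>threshold s * R\<close>.\<close>

lemma answer_small_old:
  assumes \<kappa>: "tilt \<kappa>" and A: "A \<subseteq> {1..n}" and m: "prior s X lv m"
    and X: "finite X" "card X \<le> q" "inj_on lv X" "\<And>x. x \<in> X \<Longrightarrow> lv x < r"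
    and F: "card (A - X) \<le> threshold s"
    and x: "x \<in> A \<inter> X" "\<And>y. y \<in> A \<inter> X \<Longrightarrow> lv x \<le> lv y"
    and g: "\<And>a \<tau>. 0 \<le> g a \<tau> \<and> g a \<tau> \<le> 1"
  shows "\<bar>E m (answer \<kappa> s i A g) - E m (g x)\<bar> \<le> (q + 30) / R"
proof -
  define F where "F = A - X"
  define w where "w = W s (lv x)"
  have w: "0 < w" by (simp add: w_def W_pos)
  note fin = finite_prior[OF prior_finite[OF m]]
  note int = integrable_measure_pmf_finite[OF fin]
  have finA: "finite A" "finite F" using A by (auto simp: F_def intro: finite_subset)
  have B: "0 < B" using B_ge by simp
  have point: "\<bar>answer \<kappa> s i A g \<tau> - g x \<tau>\<bar>
      \<le> 20 * q / B + 10 / w * (\<Sum>a\<in>F. weight \<kappa> s i (\<tau> a))"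
    if \<tau>: "\<tau> \<in> set_pmf (types m)" for \<tau>
  proof -
    have lv: "fst (\<tau> y) = lv y" if "y \<in> A \<inter> X" for y
    proof -
      have "\<tau> y \<in> set_pmf (m y)" using types_component[OF \<tau>] that A by auto
      moreover have "set_pmf (m y) \<subseteq> {lv y} \<times> UNIV" using m that by (auto simp: prior_def)
      ultimately show ?thesis by auto
    qed
    have "\<bar>answer \<kappa> s i A g \<tau> - g x \<tau>\<bar>
        \<le> (\<Sum>a\<in>A - {x}. weight \<kappa> s i (\<tau> a)) / weight \<kappa> s i (\<tau> x)"
      unfolding answer_def
      using finA x weight_pos[OF \<kappa>] g by (intro weighted_average_dominated) auto
    also have "\<dots> \<le> (\<Sum>a\<in>A - {x}. weight \<kappa> s i (\<tau> a)) / (w / 10)"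
      using weight_ge[OF \<kappa>, of s "\<tau> x" i] lv[OF x(1)] w
      by (intro divide_left_mono sum_nonneg mult_pos_pos less_imp_le[OF weight_pos[OF \<kappa>]] weight_pos[OF \<kappa>])
         (auto simp: w_def)
    also have "A - {x} = (A \<inter> X - {x}) \<union> F" using x by (auto simp: F_def)
    also have "(\<Sum>a\<in>(A \<inter> X - {x}) \<union> F. weight \<kappa> s i (\<tau> a)) =
        (\<Sum>a\<in>A \<inter> X - {x}. weight \<kappa> s i (\<tau> a)) + (\<Sum>a\<in>F. weight \<kappa> s i (\<tau> a))"
      using finA by (intro sum.union_disjoint) (auto simp: F_def)
    also have "(\<Sum>a\<in>A \<inter> X - {x}. weight \<kappa> s i (\<tau> a)) \<le> (\<Sum>a\<in>A \<inter> X - {x}. 2 * w / B)"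
    proof (rule sum_mono)
      fix a assume a: "a \<in> A \<inter> X - {x}"
      then have "lv a \<noteq> lv x" using x X(3) by (auto simp: inj_on_def)
      then have "B * W s (lv a) \<le> w"
        unfolding w_def using a x X(4) by (intro W_separated) (auto simp: order.strict_iff_order)
      then have "2 * W s (lv a) \<le> 2 * w / B" using B by (simp add: field_simps)
      then show "weight \<kappa> s i (\<tau> a) \<le> 2 * w / B"
        using weight_le[OF \<kappa>, of s i "\<tau> a"] lv[of a] a by simp
    qed
    also have "\<dots> \<le> q * (2 * w / B)"
    proof -
      have "card (A \<inter> X - {x}) \<le> card X" using X by (intro card_mono) auto
      then show ?thesis using X w B by (simp add: divide_right_mono mult_right_mono)
    qed
    finally show ?thesis using w B by (simp add: field_simps divide_right_mono)
  qed
  have "\<bar>E m (answer \<kappa> s i A g) - E m (g x)\<bar>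
      \<le> E m (\<lambda>\<tau>. 20 * q / B + 10 / w * (\<Sum>a\<in>F. weight \<kappa> s i (\<tau> a)))"
    by (rule abs_expectation_diff_le[OF fin point])
  also have "\<dots> = 20 * q / B + 10 / w * (\<Sum>a\<in>F. E m (\<lambda>\<tau>. weight \<kappa> s i (\<tau> a)))"
    by (simp add: int Bochner_Integration.integral_sum)
  also have "(\<Sum>a\<in>F. E m (\<lambda>\<tau>. weight \<kappa> s i (\<tau> a))) = (\<Sum>a\<in>F. R)"
  proof (rule sum.cong[OF refl])
    fix a assume "a \<in> F"
    then have "a \<in> {1..n}" "m a = base s" using A m by (auto simp: F_def prior_def)
    then show "E m (\<lambda>\<tau>. weight \<kappa> s i (\<tau> a)) = R"
      by (simp add: E_component expectation_weight[OF \<kappa>])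
  qed
  also have "\<dots> = card F * R" by simp
  also have "10 / w * (card F * R) \<le> 10 * R / B"
  proof -
    have "card F * B \<le> threshold s * B" using F B by (simp add: F_def)
    also have "\<dots> \<le> w" unfolding w_def using x X by (intro threshold_mult_B_le_W) auto
    finally have "card F * B * (10 * R) \<le> w * (10 * R)" using R_ge by (intro mult_right_mono) auto
    then show ?thesis using w B by (simp add: field_simps)
  qed
  \<comment> \<open>The factors 20 and 10 come from tilts between 1/10 and 2; this is the source of
    the 30 in the error.\<close>
  also have "20 * q / B + 10 * R / B \<le> 30 * R / B"
    using R_ge B by (simp add: add_divide_distrib[symmetric] divide_right_mono)
  also have "\<dots> = 30 / R" using R_ge by (simp add: B_def power2_eq_square)
  also have "\<dots> \<le> (q + 30) / R" using R_ge by (simp add: divide_right_mono)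
  finally show ?thesis by simp
qed

text \<open>By a union bound all queried elements are on the bottom level except with probability at
  most \<open>1 / R\<close>. There all weights are equal and untilted, so the answer is
  uniform.\<close>

lemma answer_small_fresh:
  assumes \<kappa>: "tilt \<kappa>" and A: "A \<subseteq> {1..n}" "A \<noteq> {}" and m: "prior s X lv m"
    and F: "A \<inter> X = {}" "card A \<le> threshold s"
    and g: "\<And>a \<tau>. 0 \<le> g a \<tau> \<and> g a \<tau> \<le> 1"
  shows "\<bar>E m (answer \<kappa> s i A g) - (\<Sum>a\<in>A. 1 / card A * E m (g a))\<bar> \<le> (q + 30) / R"
proof -
  let ?b = "\<lambda>t :: nat \<times> bool. of_bool (fst t < r) :: real"
  note fin = finite_prior[OF prior_finite[OF m]]
  note int = integrable_measure_pmf_finite[OF fin]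
  have finA: "finite A" using A by (auto intro: finite_subset)
  have base: "m a = base s" if "a \<in> A" for a using that F m by (auto simp: prior_def)
  have point: "\<bar>answer \<kappa> s i A g \<tau> - (\<Sum>a\<in>A. 1 / card A * g a \<tau>)\<bar> \<le> (\<Sum>a\<in>A. ?b (\<tau> a))"
    if \<tau>: "\<tau> \<in> set_pmf (types m)" for \<tau>
  proof (cases "\<exists>a\<in>A. fst (\<tau> a) < r")
    case True
    then obtain a where a: "a \<in> A" "fst (\<tau> a) < r" by auto
    have "0 \<le> answer \<kappa> s i A g \<tau>" "answer \<kappa> s i A g \<tau> \<le> 1"
      unfolding answer_def using finA A weight_pos[OF \<kappa>] g
      by (intro weighted_average_bounds; auto)+
    moreover have "0 \<le> (\<Sum>a\<in>A. 1 / card A * g a \<tau>)" "(\<Sum>a\<in>A. 1 / card A * g a \<tau>) \<le> 1"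
      using weighted_average_bounds[of A "\<lambda>_. 1" "\<lambda>a. g a \<tau>"] finA A g by auto
    moreover have "?b (\<tau> a) \<le> (\<Sum>a\<in>A. ?b (\<tau> a))"
      using a finA by (intro member_le_sum) auto
    ultimately show ?thesis using a by simp
  next
    case False
    have w: "weight \<kappa> s i (\<tau> a) = W s r" if "a \<in> A" for a
    proof -
      have "\<tau> a \<in> set_pmf (base s)"
        using types_component[OF \<tau>, of a] that A base[OF that] by auto
      then have "fst (\<tau> a) \<le> r" using set_base[of s] by auto
      then have "fst (\<tau> a) = r" using False that by force
      then show ?thesis using tiltD(5)[OF \<kappa>, of r i "snd (\<tau> a)"]
        by (metis weight_def mult.right_neutral order_refl prod.collapse)
    qed
    then have "(\<Sum>b\<in>A. weight \<kappa> s i (\<tau> b)) = card A * W s r" by simp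
    then have "answer \<kappa> s i A g \<tau> = (\<Sum>a\<in>A. W s r / (card A * W s r) * g a \<tau>)"
      unfolding answer_def by (intro sum.cong) (auto simp: w)
    then show ?thesis using W_pos[of s r] by (simp add: sum_nonneg)
  qed
  have "(\<Sum>a\<in>A. 1 / card A * E m (g a)) = E m (\<lambda>\<tau>. \<Sum>a\<in>A. 1 / card A * g a \<tau>)"
    by (simp add: int Bochner_Integration.integral_sum)
  then have "\<bar>E m (answer \<kappa> s i A g) - (\<Sum>a\<in>A. 1 / card A * E m (g a))\<bar> \<le> E m (\<lambda>\<tau>. \<Sum>a\<in>A. ?b (\<tau> a))"
    using abs_expectation_diff_le[OF fin point] by simp
  also have "\<dots> = (\<Sum>a\<in>A. E m (\<lambda>\<tau>. ?b (\<tau> a)))"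
    by (simp add: int Bochner_Integration.integral_sum)
  also have "\<dots> = (\<Sum>a\<in>A. \<Sum>l<r. 1 / W s l)"
  proof (rule sum.cong[OF refl])
    fix a assume a: "a \<in> A"
    then have "E m (\<lambda>\<tau>. ?b (\<tau> a)) = measure_pmf.expectation (base s) ?b"
      using A base[OF a] by (subst E_component) auto
    then show "E m (\<lambda>\<tau>. ?b (\<tau> a)) = (\<Sum>l<r. 1 / W s l)"
      by (simp add: expectation_base lessThan_Suc_atMost[symmetric])
  qed
  also have "\<dots> \<le> card A * (real r / (threshold s * B))"
    using mult_left_mono[OF sum_inverse_W_le[of s], of "real (card A)"] by simp
  also have "\<dots> \<le> threshold s * (real r / (threshold s * B))"
    using F B_ge B_le_threshold[of s] by (intro mult_right_mono) auto
  also have "\<dots> = r / B" using B_ge B_le_threshold[of s] by simp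
  also have "\<dots> \<le> R / B" using B_ge by (intro divide_right_mono) (auto simp: R_def)
  also have "\<dots> = 1 / R" using R_ge by (simp add: B_def power2_eq_square)
  also have "\<dots> \<le> (q + 30) / R" using R_ge by (simp add: divide_right_mono)
  finally show ?thesis by simp
qed

section \<open>Indistinguishability\<close>

definition accept :: "(side \<Rightarrow> nat \<times> bool \<Rightarrow> real) \<Rightarrow> nat \<Rightarrow> (nat \<Rightarrow> nat \<times> bool) \<Rightarrow> tester \<Rightarrow> real" where
  "accept \<kappa> s \<tau> T = accept_prob n (\<lambda>i x. weight \<kappa> s i (\<tau> x)) T"

lemma accept_bounds: "0 \<le> accept \<kappa> s \<tau> T \<and> accept \<kappa> s \<tau> T \<le> 1"
  by (simp add: accept_def accept_prob_bounds)

lemma E_accept_Coin: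
  assumes "\<And>x. finite (set_pmf (m x))"
  shows "E m (\<lambda>\<tau>. accept \<kappa> s \<tau> (Coin p T)) =
    measure_pmf.expectation p (\<lambda>x. E m (\<lambda>\<tau>. accept \<kappa> s \<tau> (T x)))"
proof -
  note fin = finite_prior[OF assms]
  have int: "integrable p (\<lambda>x. accept \<kappa> s \<tau> (T x))" for \<tau>
    using accept_bounds by (intro measure_pmf.integrable_const_bound[where B = 1]) auto
  have eq: "E m f = (\<Sum>\<tau>\<in>set_pmf (types m). f \<tau> * pmf (types m) \<tau>)" for f
    by (rule integral_measure_pmf_real[OF fin])
  show ?thesis
    unfolding eq accept_def accept_prob_Coin
    using int unfolding accept_def by (subst Bochner_Integration.integral_sum) auto
qed

lemma E_accept_Query:
  assumes "tilt \<kappa>" "A \<noteq> {}" "A \<subseteq> {1..n}"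
  shows "E m (\<lambda>\<tau>. accept \<kappa> s \<tau> (Query i A T)) = E m (answer \<kappa> s i A (\<lambda>a \<tau>. accept \<kappa> s \<tau> (T a)))"
  unfolding accept_def using assms weight_pos[OF assms(1)]
  by (subst accept_prob_Query) (auto simp: answer_def[abs_def])

text \<open>The common error of the three approximations, equal to
  \<open>1 / (100 * (q + 30))\<close>.\<close>

definition err :: real where "err = (q + 30) / R"

lemma err_nonneg: "0 \<le> err"
  using R_ge by (simp add: err_def)

text \<open>At a query whose set has \<open>f\<close> unseen elements, at most one scale has
  \<open>f\<close> strictly between its two thresholds. All scales above it see the same answer distribution,
  and so do all scales below it, whence the number of wasted scales at most doubles per query.\<close>

lemma indistinguishable:
  assumes \<kappa>: "tilt \<kappa>" "tilt \<kappa>'"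
    and "valid_tester n T" "queries_at_most T k" "finite X" "card X + k \<le> q" "inj_on lv X"
    and "\<And>x. x \<in> X \<Longrightarrow> lv x < r" "finite S"
    and "\<And>s. s \<in> S \<Longrightarrow> prior s X lv (m s)" "\<And>s. s \<in> S \<Longrightarrow> prior s X lv (m' s)"
  shows "(\<Sum>s\<in>S. \<bar>E (m s) (\<lambda>\<tau>. accept \<kappa> s \<tau> T) - E (m' s) (\<lambda>\<tau>. accept \<kappa>' s \<tau> T)\<bar>)
    \<le> 2 ^ k - 1 + 2 * real k * err * card S"
  using assms(3-)
proof (induction T arbitrary: k X lv m m' S)
  case (Output b)
  have "0 \<le> (2::real) ^ k - 1 + 2 * real k * err * card S" using err_nonneg by simp
  then show ?case by (simp add: accept_def accept_prob_Output)
next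
  case (Coin p T)
  let ?d = "\<lambda>s x. E (m s) (\<lambda>\<tau>. accept \<kappa> s \<tau> (T x)) - E (m' s) (\<lambda>\<tau>. accept \<kappa>' s \<tau> (T x))"
  have fin: "finite (set_pmf (m s x))" "finite (set_pmf (m' s x))" if "s \<in> S" for s x
    using that Coin.prems(8,9) prior_finite by blast+
  have "0 \<le> E (m s) (\<lambda>\<tau>. accept \<kappa> s \<tau> (T x)) \<and> E (m s) (\<lambda>\<tau>. accept \<kappa> s \<tau> (T x)) \<le> 1 \<and>
      0 \<le> E (m' s) (\<lambda>\<tau>. accept \<kappa>' s \<tau> (T x)) \<and> E (m' s) (\<lambda>\<tau>. accept \<kappa>' s \<tau> (T x)) \<le> 1"
    if "s \<in> S" for s x
    by (intro conjI expectation_bounds accept_bounds fin that)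
  then have int: "integrable p (\<lambda>x. E (m s) (\<lambda>\<tau>. accept \<kappa> s \<tau> (T x)))"
      "integrable p (\<lambda>x. E (m' s) (\<lambda>\<tau>. accept \<kappa>' s \<tau> (T x)))" if "s \<in> S" for s
    using that by (auto intro!: measure_pmf.integrable_const_bound[where B = 1])
  have "(\<Sum>s\<in>S. \<bar>E (m s) (\<lambda>\<tau>. accept \<kappa> s \<tau> (Coin p T)) - E (m' s) (\<lambda>\<tau>. accept \<kappa>' s \<tau> (Coin p T))\<bar>) =
      (\<Sum>s\<in>S. \<bar>measure_pmf.expectation p (?d s)\<bar>)"
    using fin int by (intro sum.cong refl) (simp add: E_accept_Coin)
  also have "\<dots> \<le> (\<Sum>s\<in>S. measure_pmf.expectation p (\<lambda>x. \<bar>?d s x\<bar>))"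
    by (intro sum_mono integral_abs_bound)
  also have "\<dots> = measure_pmf.expectation p (\<lambda>x. \<Sum>s\<in>S. \<bar>?d s x\<bar>)"
    using int by (subst Bochner_Integration.integral_sum) auto
  also have "\<dots> \<le> 2 ^ k - 1 + 2 * real k * err * card S"
  proof (rule measure_pmf.integral_le_const)
    show "integrable p (\<lambda>x. \<Sum>s\<in>S. \<bar>?d s x\<bar>)"
      using int by auto
    show "AE x in p. (\<Sum>s\<in>S. \<bar>?d s x\<bar>) \<le> 2 ^ k - 1 + 2 * real k * err * card S"
      using Coin.prems by (auto simp: AE_measure_pmf_iff intro!: Coin.IH)
  qed
  finally show ?case .
next
  case (Query i A T)
  define F where "F = A - X"
  obtain k' where k: "k = Suc k'" using Query.prems(2) by (cases k) auto
  have A: "A \<noteq> {}" "A \<subseteq> {1..n}" "finite A"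
    using Query.prems(1) by (auto intro: finite_subset)
  have sub: "valid_tester n (T a)" "queries_at_most (T a) k'" if "a \<in> A" for a
    using Query.prems(1,2) that k by auto
  have X: "finite X" "card X \<le> q" "inj_on lv X" "\<And>x. x \<in> X \<Longrightarrow> lv x < r"
    using Query.prems by auto
  let ?y = "\<lambda>s. E (m s) (\<lambda>\<tau>. accept \<kappa> s \<tau> (Query i A T))"
  let ?z = "\<lambda>s. E (m' s) (\<lambda>\<tau>. accept \<kappa>' s \<tau> (Query i A T))"
  let ?b = "\<lambda>S. 2 ^ k' - 1 + 2 * real k' * err * card S"
  have b: "0 \<le> ?b S" for S :: "nat set" using err_nonneg by simp
  \<comment> \<open>The query is small for the scales in \<open>S1\<close>, large for those in
    \<open>S2\<close>, and comparable to the weights for \<open>S3\<close>.\<close>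
  define S1 where "S1 = {s \<in> S. card F \<le> threshold s}"
  define S2 where "S2 = {s \<in> S - S1. threshold (Suc s) \<le> card F}"
  define S3 where "S3 = S - S1 - S2"
  have fin: "finite S1" "finite S2" "finite S3"
    using Query.prems(7) by (auto simp: S1_def S2_def S3_def)
  have S: "S = S1 \<union> S2 \<union> S3" "S1 \<inter> S2 = {}" "(S1 \<union> S2) \<inter> S3 = {}"
    by (auto simp: S1_def S2_def S3_def)
  note pri = Query.prems(8,9)
  have pri': "s \<in> S1 \<Longrightarrow> prior s X lv (m s)" "s \<in> S1 \<Longrightarrow> prior s X lv (m' s)"
    "s \<in> S2 \<Longrightarrow> prior s X lv (m s)" "s \<in> S2 \<Longrightarrow> prior s X lv (m' s)" for s
    using pri by (auto simp: S1_def S2_def)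
  have S1: "(\<Sum>s\<in>S1. \<bar>?y s - ?z s\<bar>) \<le> ?b S1 + 2 * err * card S1"
  proof (cases "A \<inter> X = {}")
    case True
    \<comment> \<open>The drawn element stays unseen: the approximating mixture leaves its prior at
      \<open>base s\<close>, so \<open>X\<close> and \<open>lv\<close> do not change.\<close>
    have IH: "(\<Sum>s\<in>S1. \<bar>E (m s) (\<lambda>\<tau>. accept \<kappa> s \<tau> (T a)) - E (m' s) (\<lambda>\<tau>. accept \<kappa>' s \<tau> (T a))\<bar>) \<le> ?b S1"
      if "a \<in> A" for a
      using Query.prems k fin sub[OF that] pri' by (intro Query.IH[where X = X and lv = lv]) auto
    have F: "s \<in> S1 \<Longrightarrow> card A \<le> threshold s" for s
      using True by (auto simp: S1_def F_def Diff_triv)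
    have 1: "\<bar>?y s - (\<Sum>a\<in>A. 1 / card A * E (m s) (\<lambda>\<tau>. accept \<kappa> s \<tau> (T a)))\<bar> \<le> err" if "s \<in> S1" for s
      unfolding E_accept_Query[OF \<kappa>(1) A(1,2)] err_def
      using that by (intro answer_small_fresh[OF \<kappa>(1) A(2,1) pri'(1) True F] accept_bounds)
    have 2: "\<bar>?z s - (\<Sum>a\<in>A. 1 / card A * E (m' s) (\<lambda>\<tau>. accept \<kappa>' s \<tau> (T a)))\<bar> \<le> err" if "s \<in> S1" for s
      unfolding E_accept_Query[OF \<kappa>(2) A(1,2)] err_def
      using that by (intro answer_small_fresh[OF \<kappa>(2) A(2,1) pri'(2) True F] accept_bounds)
    show ?thesis
      using A by (intro sum_abs_diff_mixture[OF 1 2 _ _ b IH]) auto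
  next
    case False
    \<comment> \<open>Least level means largest weight. The choice depends on \<open>lv\<close>
      alone, hence is the same for all scales in \<open>S1\<close>.\<close>
    define x where "x = arg_min_on lv (A \<inter> X)"
    have x: "x \<in> A \<inter> X" "\<And>y. y \<in> A \<inter> X \<Longrightarrow> lv x \<le> lv y"
      using False A(3) arg_min_if_finite(1)[of "A \<inter> X" lv] arg_min_least[of "A \<inter> X" _ lv]
      by (auto simp: x_def)
    have IH: "(\<Sum>s\<in>S1. \<bar>E (m s) (\<lambda>\<tau>. accept \<kappa> s \<tau> (T a)) - E (m' s) (\<lambda>\<tau>. accept \<kappa>' s \<tau> (T a))\<bar>) \<le> ?b S1"
      if "a \<in> {x}" for a
      using that x Query.prems k fin sub[of x] pri' by (intro Query.IH[where X = X and lv = lv]) auto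
    have 1: "\<bar>?y s - E (m s) (\<lambda>\<tau>. accept \<kappa> s \<tau> (T x))\<bar> \<le> err" if "s \<in> S1" for s
      unfolding E_accept_Query[OF \<kappa>(1) A(1,2)] err_def
      using that by (intro answer_small_old[OF \<kappa>(1) A(2) pri'(1) X _ x]) (auto simp: accept_bounds S1_def F_def)
    have 2: "\<bar>?z s - E (m' s) (\<lambda>\<tau>. accept \<kappa>' s \<tau> (T x))\<bar> \<le> err" if "s \<in> S1" for s
      unfolding E_accept_Query[OF \<kappa>(2) A(1,2)] err_def
      using that by (intro answer_small_old[OF \<kappa>(2) A(2) pri'(2) X _ x]) (auto simp: accept_bounds S1_def F_def)
    show ?thesis
      by (rule sum_abs_diff_mixture[OF _ _ _ _ b IH, where J = "{x}" and c = 1]) (auto simp: 1 2)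
  qed
  \<comment> \<open>A component of the mixture is a newly drawn element with a level not yet used;
    both are added to \<open>X\<close> and \<open>lv\<close> in the induction.\<close>
  define J where "J = F \<times> ({..<r} - lv ` X)"
  have S2: "(\<Sum>s\<in>S2. \<bar>?y s - ?z s\<bar>) \<le> ?b S2 + 2 * err * card S2"
  proof -
    let ?v = "\<lambda>\<kappa> m j s. E ((m s)(fst j := level_pmf \<kappa> i (snd j))) (\<lambda>\<tau>. accept \<kappa> s \<tau> (T (fst j)))"
    have IH: "(\<Sum>s\<in>S2. \<bar>?v \<kappa> m j s - ?v \<kappa>' m' j s\<bar>) \<le> ?b S2" if J: "j \<in> J" for j
    proof -
      obtain a l where j: "j = (a, l)" "a \<in> A" "a \<notin> X" "l < r" "l \<notin> lv ` X"
        using J by (cases j) (auto simp: J_def F_def)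
      have "(\<Sum>s\<in>S2. \<bar>E ((m s)(a := level_pmf \<kappa> i l)) (\<lambda>\<tau>. accept \<kappa> s \<tau> (T a)) -
          E ((m' s)(a := level_pmf \<kappa>' i l)) (\<lambda>\<tau>. accept \<kappa>' s \<tau> (T a))\<bar>) \<le> ?b S2"
      proof (rule Query.IH[where X = "insert a X" and lv = "lv(a := l)"])
        show "card (insert a X) + k' \<le> q" using Query.prems(4) X(1) j k by simp
        show "inj_on (lv(a := l)) (insert a X)"
          using X(3) j by (auto simp: inj_on_def)
        show "prior s (insert a X) (lv(a := l)) ((m s)(a := level_pmf \<kappa> i l))" if "s \<in> S2" for s
          by (rule prior_extend[OF pri'(3)[OF that]])
        show "prior s (insert a X) (lv(a := l)) ((m' s)(a := level_pmf \<kappa>' i l))" if "s \<in> S2" for s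
          by (rule prior_extend[OF pri'(4)[OF that]])
      qed (use X j sub fin in auto)
      then show ?thesis by (simp add: j)
    qed
    have 1: "\<bar>?y s - (\<Sum>j\<in>J. 1 / (card F * R) * ?v \<kappa> m j s)\<bar> \<le> err" if "s \<in> S2" for s
      using answer_large[OF \<kappa>(1) A(2) pri'(3)[OF that] X(1,2), of "\<lambda>a \<tau>. accept \<kappa> s \<tau> (T a)" i] that
      unfolding E_accept_Query[OF \<kappa>(1) A(1,2)] err_def J_def F_def
      by (simp add: accept_bounds S2_def F_def case_prod_unfold)
    have 2: "\<bar>?z s - (\<Sum>j\<in>J. 1 / (card F * R) * ?v \<kappa>' m' j s)\<bar> \<le> err" if "s \<in> S2" for s
      using answer_large[OF \<kappa>(2) A(2) pri'(4)[OF that] X(1,2), of "\<lambda>a \<tau>. accept \<kappa>' s \<tau> (T a)" i] that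
      unfolding E_accept_Query[OF \<kappa>(2) A(1,2)] err_def J_def F_def
      by (simp add: accept_bounds S2_def F_def case_prod_unfold)
    have "card ({..<r} - lv ` X) \<le> r" using card_mono[of "{..<r}" "{..<r} - lv ` X"] by simp
    then have "card J \<le> card F * r" by (simp add: J_def card_cartesian_product)
    then have "real (card J) \<le> real (card F) * real r" by (simp flip: of_nat_mult)
    also have "\<dots> \<le> card F * R" by (intro mult_left_mono) (auto simp: R_def)
    finally have "real (card J) \<le> card F * R" .
    \<comment> \<open>For empty \<open>F\<close> the division by 0 yields 0; no scale is fixed here
      that would exclude this case.\<close>
    then have "1 / (card F * R) * card J \<le> 1"
      using R_ge by (cases "card F = 0") (auto simp: field_simps)
    then show ?thesis
      using R_ge
      by (intro sum_abs_diff_mixture[OF 1 2 _ _ b IH]) auto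
  qed
  have S3: "(\<Sum>s\<in>S3. \<bar>?y s - ?z s\<bar>) \<le> 1"
  proof -
    \<comment> \<open>Two such scales \<open>s < s'\<close> would give
      \<open>card F < threshold (Suc s) \<le> threshold s' < card F\<close>.\<close>
    have "s = s'" if "s \<in> S3" "s' \<in> S3" for s s'
    proof -
      have *: "threshold s < card F" "card F < threshold (Suc s)" if "s \<in> S3" for s
        using that by (auto simp: S3_def S2_def S1_def)
      have "\<not> s < s'" if "s \<in> S3" "s' \<in> S3" for s s'
        using threshold_mono[of "Suc s" s'] *[OF that(1)] *[OF that(2)] by force
      then show ?thesis using that by (metis linorder_neqE_nat)
    qed
    then have "card S3 \<le> 1" using fin by (simp add: card_le_Suc0_iff_eq)
    moreover have "\<bar>?y s - ?z s\<bar> \<le> 1" if "s \<in> S3" for s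
    proof -
      have "s \<in> S" using that by (simp add: S3_def)
      note f = prior_finite[OF pri(1)[OF this]] prior_finite[OF pri(2)[OF this]]
      have "0 \<le> ?y s" "?y s \<le> 1" "0 \<le> ?z s" "?z s \<le> 1"
        by (intro expectation_bounds accept_bounds f)+
      then show ?thesis by linarith
    qed
    then have "(\<Sum>s\<in>S3. \<bar>?y s - ?z s\<bar>) \<le> (\<Sum>s\<in>S3. 1)" by (rule sum_mono)
    ultimately show ?thesis by simp
  qed
  have "(\<Sum>s\<in>S. \<bar>?y s - ?z s\<bar>) =
      (\<Sum>s\<in>S1. \<bar>?y s - ?z s\<bar>) + (\<Sum>s\<in>S2. \<bar>?y s - ?z s\<bar>) + (\<Sum>s\<in>S3. \<bar>?y s - ?z s\<bar>)"
    using S fin by (simp add: sum.union_disjoint)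
  also have "\<dots> \<le> (?b S1 + 2 * err * card S1) + (?b S2 + 2 * err * card S2) + 1"
    using S1 S2 S3 by linarith
  \<comment> \<open>Here \<open>2 * (2 ^ k' - 1) + 1 = 2 ^ k - 1\<close>. The query adds
    \<open>2 * err\<close> per scale, one \<open>err\<close> for each of the two pairs
    compared.\<close>
  also have "\<dots> = 2 ^ k - 1 + 2 * real k * err * (card S1 + card S2)"
    by (simp add: k algebra_simps)
  also have "\<dots> \<le> 2 ^ k - 1 + 2 * real k * err * card S"
  proof -
    have "card S = card S1 + card S2 + card S3"
      using S fin by (simp add: card_Un_disjoint)
    then show ?thesis using err_nonneg by (intro add_left_mono mult_left_mono) auto
  qed
  finally show ?case .
qed

section \<open>The equal and the far pairs\<close>

definition untilted :: "side \<Rightarrow> nat \<times> bool \<Rightarrow> real" where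
  "untilted i t = 1"

definition opposed :: "side \<Rightarrow> nat \<times> bool \<Rightarrow> real" where
  "opposed i t = (if fst t < r then if (i = First) = snd t then 19 / 10 else 1 / 10 else 1)"

lemma tilt_untilted: "tilt untilted"
  by (simp add: tilt_def untilted_def)

lemma tilt_opposed: "tilt opposed"
  by (auto simp: tilt_def opposed_def)

lemma accept_equal:
  assumes T: "equivalence_tester n (1 / 4) T" and n: "1 \<le> n"
  shows "2 / 3 \<le> accept untilted s \<tau> T"
proof -
  let ?D = "\<lambda>i. weighted_pmf {1..n} (\<lambda>x. weight untilted s i (\<tau> x))"
  have "?D First = ?D Second" by (simp add: weight_def untilted_def)
  moreover have "dist_on n (?D i)" for i
    using n weight_pos[OF tilt_untilted] by (simp add: dist_on_def set_weighted_pmf)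
  ultimately show ?thesis
    using T unfolding equivalence_tester_def accept_def accept_prob_def by metis
qed

text \<open>An event favoured by the first distribution. Its indicator has the form of a
  continuation, so its mass is an \<open>answer\<close> to the query \<open>{1..n}\<close>, whose
  mean is already estimated.\<close>

definition tagged :: "nat \<Rightarrow> (nat \<Rightarrow> nat \<times> bool) \<Rightarrow> real" where
  "tagged a \<tau> = of_bool (fst (\<tau> a) < r \<and> snd (\<tau> a))"

definition advantage :: "nat \<Rightarrow> (nat \<Rightarrow> nat \<times> bool) \<Rightarrow> real" where
  "advantage s \<tau> =
     answer opposed s First {1..n} tagged \<tau> - answer opposed s Second {1..n} tagged \<tau>"

text \<open>The advantage is at most the total variation distance and has mean close to \<open>9/10\<close>; the
  linear bound below does duty for Markov's inequality.\<close>

lemma accept_far: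
  assumes T: "equivalence_tester n (1 / 4) T" and n: "1 \<le> n"
  shows "3 * accept opposed s \<tau> T \<le> 1 + 4 * (1 - advantage s \<tau>)"
proof -
  define D where "D i = weighted_pmf {1..n} (\<lambda>x. weight opposed s i (\<tau> x))" for i
  define A where "A = {x \<in> {1..n}. fst (\<tau> x) < r \<and> snd (\<tau> x)}"
  note pos = weight_pos[OF tilt_opposed]
  have dist: "dist_on n (D i)" for i
    using n pos by (simp add: dist_on_def D_def set_weighted_pmf)
  have sum: "answer opposed s i {1..n} tagged \<tau> = (\<Sum>x\<in>A. pmf (D i) x)" for i
  proof -
    have "answer opposed s i {1..n} tagged \<tau> = (\<Sum>x\<in>{1..n}. if x \<in> A then pmf (D i) x else 0)"
      unfolding answer_def D_def using n pos
      by (intro sum.cong refl) (auto simp: pmf_weighted_pmf tagged_def A_def)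
    also have "\<dots> = (\<Sum>x\<in>A. pmf (D i) x)"
      by (subst sum.inter_filter[symmetric]) (auto simp: A_def intro: sum.cong)
    finally show ?thesis .
  qed
  have tv: "advantage s \<tau> \<le> tv_dist n (D First) (D Second)"
    unfolding advantage_def sum using dist by (intro tv_dist_ge_event) (auto simp: A_def)
  have le1: "advantage s \<tau> \<le> 1"
  proof -
    have "(\<Sum>x\<in>A. pmf (D First) x) \<le> 1"
      using measure_pmf.prob_le_1[of "D First" A]
      by (simp add: measure_measure_pmf_finite A_def)
    moreover have "0 \<le> (\<Sum>x\<in>A. pmf (D Second) x)" by (intro sum_nonneg) auto
    ultimately show ?thesis unfolding advantage_def sum by linarith
  qed
  show ?thesis
  proof (cases "1 / 4 \<le> tv_dist n (D First) (D Second)")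
    case True
    then have "2 / 3 \<le> pmf (run_tester (D First) (D Second) T) False"
      using T dist by (simp add: equivalence_tester_def)
    then have "accept opposed s \<tau> T \<le> 1 / 3"
      by (simp add: accept_def accept_prob_def D_def pmf_False_conv_True)
    then show ?thesis using le1 by simp
  next
    case False
    then have "3 \<le> 4 * (1 - advantage s \<tau>)" using tv by simp
    then show ?thesis using accept_bounds[of opposed s \<tau> T] by linarith
  qed
qed

text \<open>The whole domain is a large query with all elements unseen. Each of the \<open>r\<close>
  upper levels has mean weight 1, of which the favoured sign carries 19/20 and the other
  1/20.\<close>

lemma E_answer_tagged:
  assumes n: "threshold (Suc s) \<le> n"
  shows "\<bar>E (\<lambda>_. base s) (answer opposed s i {1..n} tagged) -
      real r / R * (if i = First then 19 / 20 else 1 / 20)\<bar> \<le> 4 / R"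
proof -
  let ?c = "if i = First then 19 / 20 else 1 / 20 :: real"
  have npos: "0 < real n" using n B_le_threshold[of "Suc s"] B_ge by linarith
  have "E (\<lambda>_. base s) (\<lambda>\<tau>. weight opposed s i (\<tau> a) * tagged a \<tau>) = r * ?c" if "a \<in> {1..n}" for a
  proof -
    let ?h = "\<lambda>t. weight opposed s i t * of_bool (fst t < r \<and> snd t)"
    have "E (\<lambda>_. base s) (\<lambda>\<tau>. weight opposed s i (\<tau> a) * tagged a \<tau>) =
        measure_pmf.expectation (base s) ?h"
      unfolding tagged_def using E_component[OF that, of "\<lambda>_. base s" ?h] by simp
    also have "\<dots> = (\<Sum>l\<le>r. if l < r then ?c else 0)"
      unfolding expectation_base using W_pos[of s]
      by (intro sum.cong refl) (auto simp: weight_def opposed_def less_imp_neq[THEN not_sym])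
    also have "\<dots> = r * ?c" by (simp add: lessThan_Suc_atMost[symmetric])
    finally show ?thesis .
  qed
  then have "(\<Sum>a\<in>{1..n}. E (\<lambda>_. base s) (\<lambda>\<tau>. weight opposed s i (\<tau> a) * tagged a \<tau>)) / (card {1..n} * R) =
      real r / R * ?c"
    using npos by (simp add: field_simps)
  moreover have "\<bar>E (\<lambda>_. base s) (answer opposed s i {1..n} tagged) -
      (\<Sum>a\<in>{1..n}. E (\<lambda>_. base s) (\<lambda>\<tau>. weight opposed s i (\<tau> a) * tagged a \<tau>)) / (card {1..n} * R)\<bar> \<le> 4 / R"
    using n finite_base by (intro answer_large_fresh[OF tilt_opposed]) (auto simp: tagged_def)
  ultimately show ?thesis by simp
qed

lemma E_advantage:
  assumes n: "threshold (Suc s) \<le> n"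
  shows "89 / 100 \<le> E (\<lambda>_. base s) (advantage s)"
proof -
  note int = integrable_measure_pmf_finite[OF finite_prior[OF finite_base]]
  have "E (\<lambda>_. base s) (advantage s) = E (\<lambda>_. base s) (answer opposed s First {1..n} tagged)
      - E (\<lambda>_. base s) (answer opposed s Second {1..n} tagged)"
    unfolding advantage_def[abs_def] by (simp add: int)
  moreover have "real r / R * (19 / 20) - 4 * (1 / R) \<le> E (\<lambda>_. base s) (answer opposed s First {1..n} tagged)"
    "E (\<lambda>_. base s) (answer opposed s Second {1..n} tagged) \<le> real r / R * (1 / 20) + 4 * (1 / R)"
    using E_answer_tagged[OF n, of First] E_answer_tagged[OF n, of Second] by (auto simp: abs_le_iff)
  moreover have "real r / R = 1 - 1 / R" using R_ge by (simp add: R_def field_simps)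
  moreover have "1 / R \<le> 1 / 90000" using R_ge by (simp add: field_simps)
  moreover have "89 / 100 \<le> a - b"
    if "x * (19 / 20) - 4 * y \<le> a" "b \<le> x * (1 / 20) + 4 * y" "x = 1 - y" "y \<le> 1 / 90000"
    for a b x y :: real
    using that by linarith
  ultimately show ?thesis by metis
qed

lemma scales_bound:
  assumes T: "equivalence_tester n (1 / 4) T" "queries_at_most T q" and n: "threshold K \<le> n"
  shows "4 * real K < 25 * 2 ^ q"
proof -
  let ?m = "\<lambda>s :: nat. \<lambda>x :: nat. base s"
  let ?y = "\<lambda>s. E (?m s) (\<lambda>\<tau>. accept untilted s \<tau> T)"
  let ?z = "\<lambda>s. E (?m s) (\<lambda>\<tau>. accept opposed s \<tau> T)"
  have n1: "1 \<le> n" using n B_le_threshold[of K] B_ge by linarith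
  note fin = finite_prior[OF finite_base]
  note int = integrable_measure_pmf_finite[OF fin]
  \<comment> \<open>A mean advantage of 89/100 bounds the acceptance of the far pair by 36/75, and
    2/3 minus this exceeds 9/50.\<close>
  have "9 / 50 \<le> \<bar>?y s - ?z s\<bar>" if "s \<in> {..<K}" for s
  proof -
    have "threshold (Suc s) \<le> n" using threshold_mono[of "Suc s" K] that n by simp
    then have "89 / 100 \<le> E (?m s) (advantage s)" by (rule E_advantage)
    moreover have "E (?m s) (\<lambda>\<tau>. 3 * accept opposed s \<tau> T) \<le> E (?m s) (\<lambda>\<tau>. 1 + 4 * (1 - advantage s \<tau>))"
      using accept_far[OF T(1) n1] by (intro expectation_mono_finite fin)
    then have "3 * ?z s \<le> 1 + 4 * (1 - E (?m s) (advantage s))"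
      by (simp add: int)
    moreover have "E (?m s) (\<lambda>_. 2 / 3) \<le> ?y s"
      using accept_equal[OF T(1) n1] by (intro expectation_mono_finite fin)
    then have "2 / 3 \<le> ?y s" by simp
    moreover have "9 / 50 \<le> y - z"
      if "89 / 100 \<le> a" "3 * z \<le> 1 + 4 * (1 - a)" "2 / 3 \<le> y" for a y z :: real
      using that by simp
    ultimately have "9 / 50 \<le> ?y s - ?z s" by blast
    then show ?thesis by linarith
  qed
  then have "(\<Sum>s\<in>{..<K}. 9 / 50) \<le> (\<Sum>s\<in>{..<K}. \<bar>?y s - ?z s\<bar>)" by (rule sum_mono)
  also have "\<dots> \<le> 2 ^ q - 1 + 2 * real q * err * card {..<K}"
    using T by (intro indistinguishable[OF tilt_untilted tilt_opposed, where X = "{}" and lv = "\<lambda>_. 0"])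
      (auto simp: equivalence_tester_def prior_def)
  also have "2 * real q * err \<le> 1 / 50"
  proof -
    have "100 * (real q * (real q + 30)) \<le> R"
      by (simp add: R_eq power2_eq_square mult_right_mono)
    then show ?thesis using R_ge by (simp add: err_def field_simps)
  qed
  \<comment> \<open>The accumulated error 1/50 leaves a gap of 4/25 per scale, against fewer than
    \<open>2 ^ q\<close> wasted scales.\<close>
  finally have "K * (9 / 50) \<le> 2 ^ q - 1 + 1 / 50 * real K" by (simp add: mult_right_mono)
  then show ?thesis by simp
qed

end

section \<open>From the number of scales to the number of queries\<close>

lemma tester_bound:
  assumes T: "equivalence_tester n (1 / 4) T" "queries_at_most T q"
  shows "ln (real n) < (700 * 2 ^ q * (real q + 30)\<^sup>2 + 1) * (2 * ln (100 * (real q + 30)\<^sup>2))"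
proof -
  define r where "r = 100 * (q + 30)\<^sup>2 - 1"
  interpret level_hierarchy n q r
    by unfold_locales (simp add: r_def)
  \<comment> \<open>Otherwise \<open>7 * 2 ^ q\<close> scales would fit, and
    \<open>4 * 7 > 25\<close> contradicts \<open>scales_bound\<close>.\<close>
  have "real n < threshold (7 * 2 ^ q)"
  proof (rule ccontr)
    assume "\<not> real n < threshold (7 * 2 ^ q)"
    from scales_bound[OF T, of "7 * 2 ^ q"] this have "4 * real (7 * 2 ^ q) < 25 * 2 ^ q" by simp
    then show False by simp
  qed
  show ?thesis
  proof (cases "n = 0")
    \<comment> \<open>Since \<open>ln 0 = 0\<close>, only positivity of the right side
      remains.\<close>
    case True
    have "1 \<le> 100 * (real q + 30)\<^sup>2" using R_ge by (simp add: R_eq)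
    then have "0 < ln (100 * (real q + 30)\<^sup>2)" using R_ge by (simp add: R_eq)
    then show ?thesis using True by (simp add: add_pos_nonneg add_nonneg_pos)
  next
    case False
    then have "ln (real n) < ln (threshold (7 * 2 ^ q))"
      using \<open>real n < threshold (7 * 2 ^ q)\<close> by simp
    also have "\<dots> = (real (7 * 2 ^ q * (r + 1) + 1)) * ln B"
      unfolding threshold_def using B_ge by (subst ln_realpow) auto
    also have "real (7 * 2 ^ q * (r + 1) + 1) = 7 * 2 ^ q * R + 1"
      by (simp add: R_def algebra_simps)
    also have "ln B = 2 * ln R" using R_ge by (simp add: B_def ln_realpow)
    finally show ?thesis by (simp add: R_eq mult.assoc)
  qed
qed

theorem theorem1:
  "\<exists>(c::real) (k::nat) (N::nat). c > 0 \<and>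
     (\<forall>n\<ge>N. \<forall>T q. equivalence_tester n (1 / 4) T \<longrightarrow> queries_at_most T q \<longrightarrow>
        real q \<ge> c * (ln (ln (real n)) / ln (ln (ln (real n))) ^ k))"
proof -
  \<comment> \<open>The bound of \<open>tester_bound\<close> with \<open>2 ^ q\<close> enlarged to
    \<open>exp q\<close>. It is eventually below \<open>exp (3 * q)\<close>, which yields the
    constant 1/3.\<close>
  define f :: "nat \<Rightarrow> real" where
    "f q = (700 * exp (real q) * (real q + 30)\<^sup>2 + 1) * (2 * ln (100 * (real q + 30)\<^sup>2))" for q
  have "eventually (\<lambda>q. f q \<le> exp (3 * real q)) sequentially"
    unfolding f_def by real_asymp
  then obtain q0 where q0: "\<And>q. q \<ge> q0 \<Longrightarrow> f q \<le> exp (3 * real q)"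
    by (auto simp: eventually_sequentially)
  have bound: "ln (real n) < f q" if "equivalence_tester n (1 / 4) T" "queries_at_most T q" for n T q
  proof -
    have "2 \<le> exp (1::real)" using exp_ge_add_one_self[of 1] by simp
    then have "2 ^ q \<le> exp (1::real) ^ q" by (intro power_mono) auto
    then have "(2::real) ^ q \<le> exp (real q)" by (simp flip: exp_of_nat_mult)
    moreover have "1 \<le> 100 * (real q + 30)\<^sup>2" by (simp add: power2_eq_square algebra_simps)
    ultimately show ?thesis
      unfolding f_def
      by (intro less_le_trans[OF tester_bound[OF that]] mult_right_mono add_mono mult_left_mono) auto
  qed
  \<comment> \<open>Budgets up to \<open>q0\<close> escape the asymptotic estimate; they are
    impossible once \<open>ln n\<close> reaches the maximum of \<open>f\<close> over them.\<close>
  define C where "C = Max (f ` {..q0})"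
  have "eventually (\<lambda>n. C \<le> ln (real n)) sequentially"
    by real_asymp
  then obtain N where N: "\<And>n. n \<ge> N \<Longrightarrow> C \<le> ln (real n)"
    by (auto simp: eventually_sequentially)
  have "1 / 3 * ln (ln (real n)) \<le> real q"
    if n: "n \<ge> max N 3" and T: "equivalence_tester n (1 / 4) T" "queries_at_most T q" for n T q
  proof (cases "q \<le> q0")
    case True
    then have "f q \<le> C" by (auto simp: C_def)
    then show ?thesis using N[of n] n bound[OF T] by simp
  next
    case False
    then have "ln (real n) < exp (3 * real q)"
      using q0[of q] bound[OF T] by simp
    moreover have "0 < ln (real n)" using n by simp
    ultimately have "ln (ln (real n)) < 3 * real q" by (metis ln_exp ln_less_cancel_iff exp_gt_zero)
    then show ?thesis by simp
  qed
  then show ?thesis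
    by (intro exI[of _ "1 / 3"] exI[of _ 0] exI[of _ "max N 3"]) auto
qed

end
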